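(* Let $\mu$ be a probability measure on $\mathbf R$ and let $\mathcal Q=(Q_{BB'})_{B\subseteq B'}$ be a transition system on $\mathcal A(u)$. Suppose that the following consistency condition holds: whenever $\{A_0=\emptyset',A_1,\ldots,A_n\}$ and $\{A_0=\emptyset',A'_1,\ldots,A'_n\}$ are two consistent orderings of the same finite sub-semilattice $\mathcal A'$ and $\pi$ is the permutation of $\{1,\ldots,n\}$ with $\pi(1)=1$ such that $A_i=A'_{\pi(i)}$ for all $i$, then for all $\Gamma_0,\Gamma_1,\ldots,\Gamma_n\in\mathcal B(\mathbf R)$ $$\int_{\mathbf R^{n+1}} I_{\Gamma_0}(x_0)I_{\Gamma_1}(x_1)\prod_{i=2}^n I_{\Gamma_i}(x_i-x_{i-1})\,Q_{\cup_{j=1}^{n-1}A_j,\cup_{j=1}^nA_j}(x_{n-1};dx_n)\cdots Q_{A_1,A_1\cup A_2}(x_1;dx_2)\,Q_{\emptyset'A_1}(x_0;dx_1)\,\mu(dx_0)$$ $$=\int_{\mathbf R^{n+1}} I_{\Gamma_0}(y_0)I_{\Gamma_1}(y_1)\prod_{i=2}^n I_{\Gamma_i}(y_{\pi(i)}-y_{\pi(i)-1})\,Q_{\cup_{j=1}^{n-1}A'_j,\cup_{j=1}^nA'_j}(y_{n-1};dy_n)\cdots Q_{A'_1,A'_1\cup A'_2}(y_1;dy_2)\,Q_{\emptyset'A'_1}(y_0;dy_1)\,\mu(dy_0).$$ Then there exists (on some probability space) a $\mathcal Q$-Markov process $X=(X_A)_{A\in\mathcal A}$ with initial distribution $\mu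$.
   Context: Framework. $T$ is a compact Hausdorff space and $\mathcal A$ is a collection of closed subsets of $T$ with $\emptyset,T\in\mathcal A$, closed under arbitrary intersections, containing no two disjoint non-empty sets, and separable from above: there are finite subcollections $\mathcal A_n\subseteq\mathcal A_{n+1}\subseteq\mathcal A$ closed under intersections and maps $g_n$ sending each $A\in\mathcal A$ to a finite union of sets of $\mathcal A_n$ with $A=\cap_n g_n(A)$, $g_{n+1}(A)\subseteq g_n(A)$, $A\subseteq g_n(A)^0$ (interior), $g_n(\emptyset)=\emptyset$, $g_n(\cap_\alpha A_\alpha)=\cap_\alpha g_n(A_\alpha)$ for arbitrary families, and $\cup_{i=1}^kA_i=\cup_{j=1}^mA'_j\Rightarrow\cup_{i=1}^kg_n(A_i)=\cup_{j=1}^mg_n(A'_j)$. Put $\emptyset'=\cap_{A\in\mathcal A\setminus\{\emptyset\}}A$ (a non-empty set). $\mathcal A(u)$ is the class of finite unions of sets of $\mathcal A$; $\mathcal C$ is the class of sets $A\setminus B$ with $A\in\mathcal A$, $B\in\mathcal A(u)$; $\mathcal C(u)$ is the class of finite unions of sets of $\mathcal C$. A finite sub-semilattice is a non-empty finite collection $\mathcal A'\subseteq\mathcal A$ of non-empty sets closed under intersections. A consistent ordering of $\mathcal A'$ is a list $\{A_0=\emptyset',A_1,\ldots,A_n\}$ where $A_1,\ldots,A_n$ enumerates the distinct sets of $\mathcal A'$, $A_1=\cap_{A\in\mathcal A'}A$ (possibly $A_1=A_0$), and every $A\in\mathcal A'$ with $A\subsetneq A_{i+1}$ is one of $A_1,\ldots,A_i$.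 Processes. A process $X=(X_A)_{A\in\mathcal A}$ is a family of real random variables on a complete probability space. It has a (almost surely) unique additive extension to $\mathcal A(u)$ if, whenever $\cup_{i=1}^nA_i=\cup_{j=1}^mA'_j$ with all sets in $\mathcal A$, the inclusion–exclusion sums $\sum_iX_{A_i}-\sum_{i_1<i_2}X_{A_{i_1}\cap A_{i_2}}+\cdots+(-1)^{n+1}X_{A_1\cap\cdots\cap A_n}$ and the analogous sum for the $A'_j$ coincide a.s.; the common value is $X_B$, $B=\cup_iA_i$. It has a unique additive extension to $\mathcal C$ if $A\setminus B=A'\setminus B'$ ($A,A'\in\mathcal A$, $B,B'\in\mathcal A(u)$) implies $X_A-X_{A\cap B}=X_{A'}-X_{A'\cap B'}$ a.s., the common value being $X_{A\setminus B}$ (in particular $X_\emptyset=0$ a.s.). A unique additive extension to $\mathcal C(u)$ means the analogous inclusion–exclusion consistency for finite unions of sets of $\mathcal C$. The minimal filtration is $\mathcal F_B=\sigma(X_A;A\in\mathcal A,A\subseteq B)$, $B\in\mathcal A(u)$ (completed). The initial distribution of $X$ is the law of $X_{\emptyset'}$. A transition system $\mathcal Q=(Q_{BB'})$ is a family of transition probabilities on $\mathbf R$ indexed by pairs $B\subseteq B'$ of non-empty sets in $\mathcal A(u)$ ($Q_{BB'}(x;\cdot)$ a probability measure, $Q_{BB'}(\cdot;\Gamma)$ measurable) with $Q_{BB}(x;\cdot)=\delta_x$ and $Q_{BB''}(x;\Gamma)=\int_{\mathbf R}Q_{B'B''}(y;\Gamma)Q_{BB'}(x;dy)$ for $B\subseteq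 B'\subseteq B''$. A process $X$ with a unique additive extension to $\mathcal C(u)$ is $\mathcal Q$-Markov if for all non-empty $B\subseteq B'$ in $\mathcal A(u)$ and all $\Gamma\in\mathcal B(\mathbf R)$ (Borel sets), $P[X_{B'}\in\Gamma\mid\mathcal F_B]=Q_{BB'}(X_B;\Gamma)$ a.s. *)

theory Defs
  imports "HOL-Probability.Probability"
begin

section \<open>Indexing collections\<close>

definition fin_unions :: "'t set set \<Rightarrow> 't set set" where
  "fin_unions \<A> = {\<Union>F | F. finite F \<and> F \<subseteq> \<A>}"

definition separable_from_above :: "'t::topological_space set set \<Rightarrow> bool" where
  "separable_from_above \<A> \<longleftrightarrow>
    (\<exists>(\<A>n :: nat \<Rightarrow> 't set set) (g :: nat \<Rightarrow> 't set \<Rightarrow> 't set).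
      (\<forall>n. finite (\<A>n n) \<and> \<A>n n \<subseteq> \<A>n (Suc n) \<and> \<A>n n \<subseteq> \<A> \<and>
           (\<forall>A\<in>\<A>n n. \<forall>B\<in>\<A>n n. A \<inter> B \<in> \<A>n n)) \<and>
      (\<forall>n. \<forall>A\<in>\<A>. g n A \<in> fin_unions (\<A>n n)) \<and>
      (\<forall>A\<in>\<A>. A = (\<Inter>n. g n A)) \<and>
      (\<forall>n. \<forall>A\<in>\<A>. g (Suc n) A \<subseteq> g n A) \<and>
      (\<forall>n. \<forall>A\<in>\<A>. A \<subseteq> interior (g n A)) \<and>
      (\<forall>n. g n {} = {}) \<and>
      (\<forall>n F. F \<subseteq> \<A> \<longrightarrow> F \<noteq> {} \<longrightarrow> g n (\<Inter>F) = (\<Inter>A\<in>F. g n A)) \<and>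
      (\<forall>n F G. finite F \<longrightarrow> F \<noteq> {} \<longrightarrow> F \<subseteq> \<A> \<longrightarrow> finite G \<longrightarrow> G \<noteq> {} \<longrightarrow> G \<subseteq> \<A> \<longrightarrow>
         \<Union>F = \<Union>G \<longrightarrow> (\<Union>A\<in>F. g n A) = (\<Union>A\<in>G. g n A)))"

text \<open>The space $T$ is the whole type; note that closure under arbitrary intersections
  includes \<open>\<Inter>{} = UNIV\<close>.\<close>

definition indexing_collection :: "'t::t2_space set set \<Rightarrow> bool" where
  "indexing_collection \<A> \<longleftrightarrow>
    compact (UNIV :: 't set) \<and>
    (\<forall>A\<in>\<A>. closed A) \<and>
    {} \<in> \<A> \<and> UNIV \<in> \<A> \<and>
    (\<forall>F. F \<subseteq> \<A> \<longrightarrow> \<Inter>F \<in> \<A>) \<and>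
    (\<forall>A\<in>\<A>. \<forall>B\<in>\<A>. A \<noteq> {} \<longrightarrow> B \<noteq> {} \<longrightarrow> A \<inter> B \<noteq> {}) \<and>
    separable_from_above \<A>"

definition min_set :: "'t set set \<Rightarrow> 't set" where
  "min_set \<A> = \<Inter>(\<A> - {{}})"

definition diff_sets :: "'t set set \<Rightarrow> 't set set" where
  "diff_sets \<A> = {A - B | A B. A \<in> \<A> \<and> B \<in> fin_unions \<A>}"

definition finite_subsemilattice :: "'t set set \<Rightarrow> 't set set \<Rightarrow> bool" where
  "finite_subsemilattice \<A> \<A>' \<longleftrightarrow>
    finite \<A>' \<and> \<A>' \<noteq> {} \<and> \<A>' \<subseteq> \<A> \<and> {} \<notin> \<A>' \<and>
    (\<forall>A\<in>\<A>'. \<forall>B\<in>\<A>'. A \<inter> B \<in> \<A>')"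

text \<open>A list $A_0, A_1, \ldots, A_n$ is encoded by a function on \<open>nat\<close>, of which only the values
  at \<open>0, \<dots>, n\<close> matter.\<close>

definition consistent_ordering ::
    "'t set set \<Rightarrow> 't set set \<Rightarrow> nat \<Rightarrow> (nat \<Rightarrow> 't set) \<Rightarrow> bool" where
  "consistent_ordering \<A> \<A>' n A \<longleftrightarrow>
    A 0 = min_set \<A> \<and>
    bij_betw A {1..n} \<A>' \<and>
    A 1 = \<Inter>\<A>' \<and>
    (\<forall>i<n. \<forall>B\<in>\<A>'. B \<subset> A (Suc i) \<longrightarrow> B \<in> A ` {1..i})"

section \<open>Set-indexed processes and their additive extensions\<close>

text \<open>Inclusion-exclusion sum of \<open>Y\<close> over the family $C_1, \ldots, C_n$ (repetitions allowed).\<close>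

definition incl_excl :: "('t set \<Rightarrow> 'w \<Rightarrow> real) \<Rightarrow> nat \<Rightarrow> (nat \<Rightarrow> 't set) \<Rightarrow> 'w \<Rightarrow> real" where
  "incl_excl Y n C \<omega> =
    (\<Sum>I | I \<subseteq> {1..n} \<and> I \<noteq> {}. (-1) ^ (card I + 1) * Y (\<Inter>i\<in>I. C i) \<omega>)"

definition unions_consistent ::
    "'w measure \<Rightarrow> 't set set \<Rightarrow> ('t set \<Rightarrow> 'w \<Rightarrow> real) \<Rightarrow> bool" where
  "unions_consistent M \<C> Y \<longleftrightarrow>
    (\<forall>n m C C'. n \<ge> 1 \<longrightarrow> m \<ge> 1 \<longrightarrow> (\<forall>i\<in>{1..n}. C i \<in> \<C>) \<longrightarrow> (\<forall>j\<in>{1..m}. C' j \<in> \<C>) \<longrightarrow>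
       (\<Union>i\<in>{1..n}. C i) = (\<Union>j\<in>{1..m}. C' j) \<longrightarrow>
       (AE \<omega> in M. incl_excl Y n C \<omega> = incl_excl Y m C' \<omega>))"

text \<open>The extensions are determined only almost surely; \<open>SOME\<close> picks one version, computed from
  an arbitrary representation of the set.\<close>

definition ext_unions :: "'t set set \<Rightarrow> ('t set \<Rightarrow> 'w \<Rightarrow> real) \<Rightarrow> 't set \<Rightarrow> 'w \<Rightarrow> real" where
  "ext_unions \<C> Y B =
    (SOME Z. \<exists>n C. n \<ge> 1 \<and> (\<forall>i\<in>{1..n}. C i \<in> \<C>) \<and> B = (\<Union>i\<in>{1..n}. C i) \<and>
       Z = incl_excl Y n C)"

definition ext_diff :: "'t set set \<Rightarrow> ('t set \<Rightarrow> 'w \<Rightarrow> real) \<Rightarrow> 't set \<Rightarrow> 'w \<Rightarrow> real" where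
  "ext_diff \<A> X C =
    (SOME Z. \<exists>A B. A \<in> \<A> \<and> B \<in> fin_unions \<A> \<and> C = A - B \<and>
       Z = (\<lambda>\<omega>. X A \<omega> - ext_unions \<A> X (A \<inter> B) \<omega>))"

text \<open>The clause on \<open>X {}\<close> says that the extension to \<open>diff_sets \<A>\<close> does extend \<open>X\<close>
  (take \<open>A = A - {}\<close>); the consistency of the differences alone does not imply it.\<close>

definition additive_ext_diff ::
    "'w measure \<Rightarrow> 't set set \<Rightarrow> ('t set \<Rightarrow> 'w \<Rightarrow> real) \<Rightarrow> bool" where
  "additive_ext_diff M \<A> X \<longleftrightarrow>
    unions_consistent M \<A> X \<and>
    (AE \<omega> in M. X {} \<omega> = 0) \<and>
    (\<forall>A\<in>\<A>. \<forall>A'\<in>\<A>. \<forall>B\<in>fin_unions \<A>. \<forall>B'\<in>fin_unions \<A>. A - B = A' - B' \<longrightarrow>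
       (AE \<omega> in M. X A \<omega> - ext_unions \<A> X (A \<inter> B) \<omega> =
                   X A' \<omega> - ext_unions \<A> X (A' \<inter> B') \<omega>))"

definition additive_ext_diff_unions ::
    "'w measure \<Rightarrow> 't set set \<Rightarrow> ('t set \<Rightarrow> 'w \<Rightarrow> real) \<Rightarrow> bool" where
  "additive_ext_diff_unions M \<A> X \<longleftrightarrow>
    additive_ext_diff M \<A> X \<and> unions_consistent M (diff_sets \<A>) (ext_diff \<A> X)"

definition set_indexed_process ::
    "'w measure \<Rightarrow> 't set set \<Rightarrow> ('t set \<Rightarrow> 'w \<Rightarrow> real) \<Rightarrow> bool" where
  "set_indexed_process M \<A> X \<longleftrightarrow>
    prob_space M \<and> complete_measure M \<and> (\<forall>A\<in>\<A>. X A \<in> borel_measurable M)"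

definition minimal_filtration ::
    "'w measure \<Rightarrow> 't set set \<Rightarrow> ('t set \<Rightarrow> 'w \<Rightarrow> real) \<Rightarrow> 't set \<Rightarrow> 'w measure" where
  "minimal_filtration M \<A> X B =
    sigma (space M)
      ({X A -` \<Gamma> \<inter> space M | A \<Gamma>. A \<in> \<A> \<and> A \<subseteq> B \<and> \<Gamma> \<in> sets borel} \<union> null_sets M)"

section \<open>Transition systems and the Markov property\<close>

definition transition_system ::
    "'t set set \<Rightarrow> ('t set \<Rightarrow> 't set \<Rightarrow> real \<Rightarrow> real measure) \<Rightarrow> bool" where
  "transition_system \<A> Q \<longleftrightarrow>
    (\<forall>B\<in>fin_unions \<A> - {{}}. \<forall>B'\<in>fin_unions \<A> - {{}}. B \<subseteq> B' \<longrightarrow>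
       Q B B' \<in> borel \<rightarrow>\<^sub>M prob_algebra borel) \<and>
    (\<forall>B\<in>fin_unions \<A> - {{}}. \<forall>x. Q B B x = return borel x) \<and>
    (\<forall>B\<in>fin_unions \<A> - {{}}. \<forall>B'\<in>fin_unions \<A> - {{}}. \<forall>B''\<in>fin_unions \<A> - {{}}.
       B \<subseteq> B' \<longrightarrow> B' \<subseteq> B'' \<longrightarrow>
       (\<forall>x. \<forall>\<Gamma>\<in>sets borel.
          emeasure (Q B B'' x) \<Gamma> = (\<integral>\<^sup>+y. emeasure (Q B' B'' y) \<Gamma> \<partial>Q B B' x)))"

definition Q_Markov ::
    "'w measure \<Rightarrow> 't set set \<Rightarrow> ('t set \<Rightarrow> 't set \<Rightarrow> real \<Rightarrow> real measure) \<Rightarrow>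
     ('t set \<Rightarrow> 'w \<Rightarrow> real) \<Rightarrow> bool" where
  "Q_Markov M \<A> Q X \<longleftrightarrow>
    set_indexed_process M \<A> X \<and> additive_ext_diff_unions M \<A> X \<and>
    (\<forall>B\<in>fin_unions \<A> - {{}}. \<forall>B'\<in>fin_unions \<A> - {{}}. B \<subseteq> B' \<longrightarrow>
       (\<forall>\<Gamma>\<in>sets borel. AE \<omega> in M.
          real_cond_exp M (minimal_filtration M \<A> X B)
            (\<lambda>\<omega>. indicator \<Gamma> (ext_unions \<A> X B' \<omega>)) \<omega>
          = measure (Q B B' (ext_unions \<A> X B \<omega>)) \<Gamma>))"

text \<open>\<open>path_integral \<mu> Q A n f\<close> is the iterated integral of $f(x_0, \ldots, x_n)$ against
  $Q_{U_{n-1} U_n}(x_{n-1}; dx_n) \cdots Q_{U_0 U_1}(x_0; dx_1)\, \mu(dx_0)$ with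
  $U_i = A_0 \cup \cdots \cup A_i$. In a consistent ordering $A_0$ is contained in every $A_j$, so
  $U_0 = A_0$ and $U_i = A_1 \cup \cdots \cup A_i$ for $i \geq 1$.\<close>

primrec path_integral ::
    "real measure \<Rightarrow> ('t set \<Rightarrow> 't set \<Rightarrow> real \<Rightarrow> real measure) \<Rightarrow> (nat \<Rightarrow> 't set) \<Rightarrow> nat \<Rightarrow>
     ((nat \<Rightarrow> real) \<Rightarrow> ennreal) \<Rightarrow> ennreal" where
  "path_integral \<mu> Q A 0 f = (\<integral>\<^sup>+x\<^sub>0. f ((\<lambda>_. 0)(0 := x\<^sub>0)) \<partial>\<mu>)"
| "path_integral \<mu> Q A (Suc n) f =
    path_integral \<mu> Q A n
      (\<lambda>x. \<integral>\<^sup>+y. f (x(Suc n := y)) \<partial>Q (\<Union>j\<le>n. A j) (\<Union>j\<le>Suc n. A j) (x n))"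

end

theory Submission
  imports Defs
begin

text \<open>The process comes from Kolmogorov's extension theorem; what has to be found is a projective family
  of finite-dimensional laws, and it has to be shown that additivity and the Markov property can be
  read off from it.

  Finite-dimensional laws. Let \<open>A\<^sub>1, \<dots>, A\<^sub>n\<close> be a consistent ordering of a finite
  semilattice \<open>S\<close>. The unions \<open>U\<^sub>i = A\<^sub>1 \<union> \<dots> \<union> A\<^sub>i\<close> increase, so \<open>\<mu>\<close>
  and \<open>Q\<close> define a Markov chain \<open>x\<^sub>0, \<dots>, x\<^sub>n\<close>, in which \<open>x\<^sub>0\<close> plays the
  role of the value at the smallest set \<open>min_set \<A>\<close>, and \<open>x\<^sub>i\<close> that of the value
  at \<open>U\<^sub>i\<close>. Its \<open>i\<close>-th increment plays the role of the value at the left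
  neighbourhood \<open>A\<^sub>i - U\<^sub>i\<^sub>-\<^sub>1\<close>. The left neighbourhoods are disjoint, and each
  \<open>D \<in> S\<close> is the union of those with \<open>A\<^sub>i \<subseteq> D\<close>; this forces the value at \<open>D\<close> to be
  the sum of the corresponding increments (\<open>set_value\<close>). The consistency condition says that the
  increments, labelled by the sets of \<open>S\<close> instead of by position, have a law that does not depend on
  the ordering (\<open>increments_permute\<close>).

  Projectivity. If \<open>S \<subseteq> S'\<close>, then \<open>S'\<close> can be ordered in blocks: the sets below
  \<open>A\<^sub>1\<close>, then the remaining sets below \<open>A\<^sub>2\<close>, and so on. The unions at the ends of the
  blocks are the \<open>U\<^sub>i\<close>, so by the Chapman-Kolmogorov equations the chain of \<open>S'\<close>, observed at
  the ends of the blocks, is the chain of \<open>S\<close> (\<open>distr_coarsen\<close>), and the sum that gives the value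
  at \<open>D \<in> S\<close> is the same sum grouped by blocks (\<open>refine_ordering\<close>).

  Additivity. If a left neighbourhood is empty, then \<open>U\<^sub>i = U\<^sub>i\<^sub>-\<^sub>1\<close>, the kernel is a
  point mass, and the increment vanishes almost surely. Each other increment can be carried by a point
  of its left neighbourhood. Hence, almost surely, the process agrees on any given finite part of
  \<open>\<A>\<close> with a finite signed measure (\<open>set_value_point_masses\<close>), and every linear relation
  between indicator functions of sets of \<open>\<A>\<close> holds for the process (\<open>linear_relation\<close>). By the
  inclusion-exclusion formula for indicator functions, all the clauses on additive extensions are
  relations of this kind (\<open>additive_ext_diff_unionsI\<close>).

  Markov property. Given \<open>B \<subseteq> B'\<close> and finitely many sets of \<open>\<A>\<close> inside \<open>B\<close>, take a
  semilattice that contains all the sets involved, and order first its sets inside \<open>B\<close>, then those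
  inside \<open>B'\<close>. The values at \<open>B\<close> and \<open>B'\<close> are then values \<open>x\<^sub>p\<close> and \<open>x\<^sub>q\<close> of the
  chain, and the event inside \<open>B\<close> depends only on the chain up to time \<open>p\<close>
  (\<open>markov_on_cylinders\<close>). Such events, together with the null sets, generate the filtration.\<close>

section \<open>Inhomogeneous Markov chains on the line\<close>

abbreviation path_space :: "(nat \<Rightarrow> real) measure" where
  "path_space \<equiv> PiM UNIV (\<lambda>_. borel)"

text \<open>A chain of length \<open>n\<close> is stored as an infinite path that is \<open>0\<close> after time \<open>n\<close>, which puts the
  laws of all lengths on one space.\<close>

primrec chain_law ::
    "real measure \<Rightarrow> (nat \<Rightarrow> nat \<Rightarrow> real \<Rightarrow> real measure) \<Rightarrow> nat \<Rightarrow> (nat \<Rightarrow> real) measure" where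
  "chain_law \<mu> P 0 = distr \<mu> path_space (\<lambda>x. (\<lambda>_. 0)(0 := x))"
| "chain_law \<mu> P (Suc n) =
    chain_law \<mu> P n \<bind> (\<lambda>x. distr (P n (Suc n) (x n)) path_space (\<lambda>y. x(Suc n := y)))"

text \<open>Forgetting the coordinates after \<open>m\<close> turns dependence on the past into a plain equation: a
  function depends only on the chain up to time \<open>m\<close> if it is a function of \<open>stop_path m x\<close>.\<close>

definition stop_path :: "nat \<Rightarrow> (nat \<Rightarrow> real) \<Rightarrow> nat \<Rightarrow> real" where
  "stop_path m x = (\<lambda>j. if j \<le> m then x j else 0)"

lemma measurable_into_path_space:
  assumes "\<And>i. (\<lambda>x. f x i) \<in> borel_measurable M"
  shows "f \<in> M \<rightarrow>\<^sub>M path_space"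
  by (rule measurable_PiM_single') (use assms in auto)

lemma measurable_path_component [measurable]:
  "(\<lambda>x. x i) \<in> borel_measurable path_space"
  by (rule measurable_component_singleton) simp

lemma measurable_path_upd:
  assumes "g \<in> M \<rightarrow>\<^sub>M path_space" "h \<in> borel_measurable M"
  shows "(\<lambda>z. (g z)(k := h z)) \<in> M \<rightarrow>\<^sub>M path_space"
proof (rule measurable_into_path_space)
  fix i
  have "(\<lambda>z. g z i) \<in> borel_measurable M"
    using measurable_compose[OF assms(1) measurable_path_component] .
  then show "(\<lambda>z. ((g z)(k := h z)) i) \<in> borel_measurable M"
    using assms(2) by (cases "i = k") auto
qed

lemma measurable_start_path: "(\<lambda>x. (\<lambda>_. 0)(0 := x)) \<in> borel \<rightarrow>\<^sub>M path_space"
  by (intro measurable_path_upd measurable_const) (auto simp: space_PiM)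

lemma measurable_stop_path [measurable]: "stop_path m \<in> path_space \<rightarrow>\<^sub>M path_space"
  unfolding stop_path_def by (rule measurable_into_path_space) measurable

text \<open>The kernel \<open>P i j\<close> moves the chain from time \<open>i\<close> to time \<open>j\<close>; only \<open>P i (Suc i)\<close> enters the
  law, and the Chapman-Kolmogorov equations tie the others to it.\<close>

locale inhomogeneous_chain =
  fixes \<mu> :: "real measure" and P :: "nat \<Rightarrow> nat \<Rightarrow> real \<Rightarrow> real measure" and n :: nat
  assumes prob_init: "prob_space \<mu>" and sets_init: "sets \<mu> = sets borel"
    and kernel: "\<And>i j. i \<le> j \<Longrightarrow> j \<le> n \<Longrightarrow> P i j \<in> borel \<rightarrow>\<^sub>M prob_algebra borel"
    and kernel_refl: "\<And>i x. i \<le> n \<Longrightarrow> P i i x = return borel x"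
    and chapman_kolmogorov: "\<And>i j k x \<Gamma>. i \<le> j \<Longrightarrow> j \<le> k \<Longrightarrow> k \<le> n \<Longrightarrow> \<Gamma> \<in> sets borel \<Longrightarrow>
      emeasure (P i k x) \<Gamma> = (\<integral>\<^sup>+y. emeasure (P j k y) \<Gamma> \<partial>P i j x)"
begin

lemma kernel_in:
  assumes "i \<le> j" "j \<le> n"
  shows "prob_space (P i j x)" "sets (P i j x) = sets borel" "space (P i j x) = UNIV"
proof -
  have "P i j x \<in> space (prob_algebra borel)"
    by (rule measurable_space[OF kernel[OF assms]]) simp
  then show "prob_space (P i j x)" "sets (P i j x) = sets borel"
    by (auto simp: space_prob_algebra)
  then show "space (P i j x) = UNIV"
    using sets_eq_imp_space_eq[of "P i j x" borel] by simp
qed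

lemma nn_integral_chapman_kolmogorov:
  assumes "i \<le> j" "j \<le> k" "k \<le> n" and f: "f \<in> borel_measurable borel"
  shows "(\<integral>\<^sup>+z. f z \<partial>P i k x) = (\<integral>\<^sup>+y. (\<integral>\<^sup>+z. f z \<partial>P j k y) \<partial>P i j x)"
proof -
  have jn: "j \<le> n" and ik: "i \<le> k" using assms by simp_all
  note s = kernel_in[OF assms(1) jn, of x] kernel_in[OF ik assms(3), of x]
  have jk: "P j k \<in> P i j x \<rightarrow>\<^sub>M subprob_algebra borel"
    unfolding measurable_cong_sets[OF s(2) refl]
    by (rule measurable_prob_algebraD[OF kernel[OF assms(2,3)]])
  have ne: "space (P i j x) \<noteq> {}" using s(3) by simp
  have "P i k x = P i j x \<bind> P j k"
  proof (rule measure_eqI)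
    show "sets (P i k x) = sets (P i j x \<bind> P j k)"
      unfolding s(5) by (rule sets_bind[symmetric]) (use kernel_in(2)[OF assms(2,3)] ne in auto)
  next
    fix A assume "A \<in> sets (P i k x)"
    then have A: "A \<in> sets borel" unfolding s(5) .
    show "emeasure (P i k x) A = emeasure (P i j x \<bind> P j k) A"
      unfolding emeasure_bind[OF ne jk A] by (rule chapman_kolmogorov[OF assms(1-3) A])
  qed
  then show ?thesis using nn_integral_bind[OF f jk] by simp
qed

lemma measurable_integral_kernel:
  assumes "i \<le> j" "j \<le> n" and f: "case_prod f \<in> borel_measurable (M \<Otimes>\<^sub>M borel)"
    and g: "g \<in> borel_measurable M"
  shows "(\<lambda>x. \<integral>\<^sup>+y. f x y \<partial>P i j (g x)) \<in> borel_measurable M"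
  by (rule nn_integral_measurable_subprob_algebra2[OF f
        measurable_compose[OF g measurable_prob_algebraD[OF kernel[OF assms(1,2)]]]])

lemma measurable_step:
  assumes "Suc m \<le> n"
  shows "(\<lambda>x. distr (P m (Suc m) (x m)) path_space (\<lambda>y. x(Suc m := y)))
    \<in> path_space \<rightarrow>\<^sub>M prob_algebra path_space"
proof (rule measurable_distr_prob_space2)
  show "(\<lambda>x. P m (Suc m) (x m)) \<in> path_space \<rightarrow>\<^sub>M prob_algebra borel"
    by (rule measurable_compose[OF measurable_path_component kernel]) (use assms in auto)
  show "(\<lambda>(x, y). x(Suc m := y)) \<in> path_space \<Otimes>\<^sub>M borel \<rightarrow>\<^sub>M path_space"
    unfolding case_prod_unfold by (rule measurable_path_upd[OF measurable_fst measurable_snd])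
qed

lemma chain_law_in: "m \<le> n \<Longrightarrow> chain_law \<mu> P m \<in> space (prob_algebra path_space)"
proof (induction m)
  case 0
  have "(\<lambda>x. (\<lambda>_. 0)(0 := x)) \<in> \<mu> \<rightarrow>\<^sub>M path_space"
    using measurable_start_path measurable_cong_sets[OF sets_init refl] by auto
  then show ?case
    using prob_space.prob_space_distr[OF prob_init] by (auto simp: space_prob_algebra)
next
  case (Suc m)
  then have m: "chain_law \<mu> P m \<in> space (prob_algebra path_space)" by simp
  show ?case
    using prob_space_bind'[OF m measurable_step] sets_bind'[OF m measurable_step] Suc.prems
    by (auto simp: space_prob_algebra)
qed

lemma chain_law_props:
  assumes "m \<le> n"
  shows "prob_space (chain_law \<mu> P m)" "sets (chain_law \<mu> P m) = sets path_space"
    "space (chain_law \<mu> P m) = UNIV"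
  using chain_law_in[OF assms] sets_eq_imp_space_eq[of "chain_law \<mu> P m" path_space]
  by (auto simp: space_prob_algebra space_PiM)

lemma measurable_chain_law: "m \<le> n \<Longrightarrow> measurable (chain_law \<mu> P m) N = measurable path_space N"
  by (intro measurable_cong_sets chain_law_props refl)

lemma nn_integral_chain_law_0:
  assumes "f \<in> borel_measurable path_space"
  shows "(\<integral>\<^sup>+x. f x \<partial>chain_law \<mu> P 0) = (\<integral>\<^sup>+x. f ((\<lambda>_. 0)(0 := x)) \<partial>\<mu>)"
proof -
  have "(\<lambda>x. (\<lambda>_. 0)(0 := x)) \<in> \<mu> \<rightarrow>\<^sub>M path_space"
    using measurable_start_path measurable_cong_sets[OF sets_init refl] by auto
  then show ?thesis unfolding chain_law.simps by (rule nn_integral_distr) (use assms in simp)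
qed

lemma nn_integral_chain_law_Suc:
  assumes m: "Suc m \<le> n" and f: "f \<in> borel_measurable path_space"
  shows "(\<integral>\<^sup>+x. f x \<partial>chain_law \<mu> P (Suc m)) =
    (\<integral>\<^sup>+x. (\<integral>\<^sup>+y. f (x(Suc m := y)) \<partial>P m (Suc m) (x m)) \<partial>chain_law \<mu> P m)"
proof -
  have upd: "(\<lambda>y. x(Suc m := y)) \<in> P m (Suc m) (x m) \<rightarrow>\<^sub>M path_space" for x
    unfolding measurable_cong_sets[OF kernel_in(2)[OF le_SucI[OF order_refl] m] refl]
    by (rule measurable_path_upd) (auto simp: space_PiM)
  have step: "(\<lambda>x. distr (P m (Suc m) (x m)) path_space (\<lambda>y. x(Suc m := y)))
      \<in> chain_law \<mu> P m \<rightarrow>\<^sub>M subprob_algebra path_space"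
    using measurable_prob_algebraD[OF measurable_step[OF m]] m by (simp add: measurable_chain_law)
  have "(\<integral>\<^sup>+z. f z \<partial>distr (P m (Suc m) (x m)) path_space (\<lambda>y. x(Suc m := y))) =
      (\<integral>\<^sup>+y. f (x(Suc m := y)) \<partial>P m (Suc m) (x m))" for x
    by (rule nn_integral_distr[OF upd]) (use f in simp)
  then show ?thesis
    unfolding chain_law.simps nn_integral_bind[OF f step] by (simp only:)
qed

text \<open>The Markov property of the chain over several steps. Each further step integrates out one
  intermediate coordinate, and the equation of Chapman and Kolmogorov absorbs it into the kernel.\<close>

lemma nn_integral_jump:
  assumes "m + d \<le> n" and f: "case_prod f \<in> borel_measurable (path_space \<Otimes>\<^sub>M borel)"
  shows "(\<integral>\<^sup>+x. f (stop_path m x) (x (m + d)) \<partial>chain_law \<mu> P (m + d)) =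
    (\<integral>\<^sup>+x. (\<integral>\<^sup>+y. f (stop_path m x) y \<partial>P m (m + d) (x m)) \<partial>chain_law \<mu> P m)"
  using assms
proof (induction d arbitrary: f)
  case 0
  have "(\<lambda>y. f (stop_path m x) y) \<in> borel_measurable borel" for x
    using measurable_compose_Pair1[OF _ 0(2)] by (simp add: space_PiM)
  then show ?case using 0 by (simp add: kernel_refl nn_integral_return)
next
  case (Suc d)
  define g where "g x z = (\<integral>\<^sup>+y. f x y \<partial>P (m + d) (m + Suc d) z)" for x z
  have fm: "(\<lambda>y. f x y) \<in> borel_measurable borel" for x
    using measurable_compose_Pair1[OF _ Suc.prems(2)] by (simp add: space_PiM)
  have g: "case_prod g \<in> borel_measurable (path_space \<Otimes>\<^sub>M borel)"
    unfolding g_def case_prod_unfold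
  proof (rule measurable_integral_kernel)
    have "(\<lambda>w. case_prod f (fst (fst w), snd w))
        \<in> borel_measurable ((path_space \<Otimes>\<^sub>M borel) \<Otimes>\<^sub>M borel)"
      by (rule measurable_compose[OF _ Suc.prems(2)]) measurable
    then show "(\<lambda>(x, y). f (fst x) y) \<in> borel_measurable ((path_space \<Otimes>\<^sub>M borel) \<Otimes>\<^sub>M borel)"
      by (simp add: case_prod_unfold)
  qed (use Suc.prems in auto)
  have F: "(\<lambda>x. f (stop_path m x) (x (m + Suc d))) \<in> borel_measurable path_space"
  proof -
    have "(\<lambda>x. case_prod f (stop_path m x, x (m + Suc d))) \<in> borel_measurable path_space"
      by (rule measurable_compose[OF _ Suc.prems(2)]) measurable
    then show ?thesis by simp
  qed
  have stop: "stop_path m (x(Suc (m + d) := y)) = stop_path m x" for x y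
    by (auto simp: stop_path_def fun_eq_iff)
  have "(\<integral>\<^sup>+x. f (stop_path m x) (x (m + Suc d)) \<partial>chain_law \<mu> P (m + Suc d)) =
      (\<integral>\<^sup>+x. g (stop_path m x) (x (m + d)) \<partial>chain_law \<mu> P (m + d))"
    using nn_integral_chain_law_Suc[OF _ F] Suc.prems by (simp add: g_def stop del: chain_law.simps)
  also have "\<dots> = (\<integral>\<^sup>+x. (\<integral>\<^sup>+z. g (stop_path m x) z \<partial>P m (m + d) (x m)) \<partial>chain_law \<mu> P m)"
    using Suc.IH[OF _ g] Suc.prems by simp
  also have "\<dots> = (\<integral>\<^sup>+x. (\<integral>\<^sup>+y. f (stop_path m x) y \<partial>P m (m + Suc d) (x m)) \<partial>chain_law \<mu> P m)"
    unfolding g_def using nn_integral_chapman_kolmogorov[of m "m + d" "m + Suc d"] fm Suc.prems by simp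
  finally show ?case .
qed

text \<open>The future does not disturb the law of the past, because kernels have total mass \<open>1\<close>.\<close>

lemma nn_integral_stop:
  assumes "m \<le> k" "k \<le> n" and f: "f \<in> borel_measurable path_space"
  shows "(\<integral>\<^sup>+x. f (stop_path m x) \<partial>chain_law \<mu> P k) = (\<integral>\<^sup>+x. f (stop_path m x) \<partial>chain_law \<mu> P m)"
proof -
  have c: "(\<integral>\<^sup>+y. f (stop_path m x) \<partial>P m k (x m)) = f (stop_path m x)" for x
    using prob_space.emeasure_space_1[OF kernel_in(1)] assms by simp
  have "(\<lambda>(x, y). f x) \<in> borel_measurable (path_space \<Otimes>\<^sub>M borel)"
    using f by (simp add: case_prod_unfold measurable_compose[OF measurable_fst])
  from nn_integral_jump[OF _ this, of m "k - m"] assms(1,2)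
  have "(\<integral>\<^sup>+x. f (stop_path m x) \<partial>chain_law \<mu> P k) =
      (\<integral>\<^sup>+x. (\<integral>\<^sup>+y. f (stop_path m x) \<partial>P m k (x m)) \<partial>chain_law \<mu> P m)"
    by (simp del: nn_integral_const)
  then show ?thesis by (simp only: c)
qed

lemma nn_integral_jump_within:
  assumes "m \<le> k" "k \<le> n" and f: "case_prod f \<in> borel_measurable (path_space \<Otimes>\<^sub>M borel)"
  shows "(\<integral>\<^sup>+x. f (stop_path m x) (x k) \<partial>chain_law \<mu> P n) =
    (\<integral>\<^sup>+x. (\<integral>\<^sup>+y. f (stop_path m x) y \<partial>P m k (x m)) \<partial>chain_law \<mu> P n)"
proof -
  have stop: "stop_path m (stop_path k x) = stop_path m x" "stop_path k x k = x k"
    "stop_path m x m = x m" for x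
    using assms(1) by (auto simp: stop_path_def fun_eq_iff)
  have "(\<lambda>x. case_prod f (stop_path m x, x k)) \<in> borel_measurable path_space"
    by (rule measurable_compose[OF _ f]) measurable
  then have F: "(\<lambda>x. f (stop_path m x) (x k)) \<in> borel_measurable path_space" by simp
  have G: "(\<lambda>x. \<integral>\<^sup>+y. f x y \<partial>P m k (x m)) \<in> borel_measurable path_space"
    by (rule measurable_integral_kernel) (use assms in auto)
  have "(\<integral>\<^sup>+x. f (stop_path m x) (x k) \<partial>chain_law \<mu> P n) =
      (\<integral>\<^sup>+x. f (stop_path m x) (x k) \<partial>chain_law \<mu> P k)"
    using nn_integral_stop[OF assms(2) order_refl F] by (simp add: stop)
  also have "\<dots> = (\<integral>\<^sup>+x. (\<integral>\<^sup>+y. f (stop_path m x) y \<partial>P m k (x m)) \<partial>chain_law \<mu> P m)"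
    using nn_integral_jump[OF _ f, of m "k - m"] assms by simp
  also have "\<dots> = (\<integral>\<^sup>+x. (\<integral>\<^sup>+y. f (stop_path m x) y \<partial>P m k (x m)) \<partial>chain_law \<mu> P n)"
    using nn_integral_stop[OF _ order_refl G, of m] assms by (simp add: stop)
  finally show ?thesis .
qed

lemma coarsen_chain:
  assumes mono: "mono_on {..k} \<phi>" and "\<phi> k \<le> n"
  shows "inhomogeneous_chain \<mu> (\<lambda>i j. P (\<phi> i) (\<phi> j)) k"
proof (rule inhomogeneous_chain.intro)
  have incr: "\<phi> i \<le> \<phi> j" if "i \<le> j" "j \<le> k" for i j
    by (rule mono_onD[OF mono]) (use that in auto)
  have bound: "\<phi> i \<le> n" if "i \<le> k" for i
    using incr[of i k] that assms(2) by auto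
  {
    fix i j assume "i \<le> j" "j \<le> k"
    then show "P (\<phi> i) (\<phi> j) \<in> borel \<rightarrow>\<^sub>M prob_algebra borel" by (intro kernel incr bound)
  next
    fix i x assume "i \<le> k"
    then show "P (\<phi> i) (\<phi> i) x = return borel x" by (intro kernel_refl bound)
  next
    fix i j l x \<Gamma> assume "i \<le> j" "j \<le> l" "l \<le> k" "\<Gamma> \<in> sets (borel :: real measure)"
    then show "emeasure (P (\<phi> i) (\<phi> l) x) \<Gamma> =
        (\<integral>\<^sup>+y. emeasure (P (\<phi> j) (\<phi> l) y) \<Gamma> \<partial>P (\<phi> i) (\<phi> j) x)"
      by (intro chapman_kolmogorov incr bound) auto
  }
qed (fact prob_init sets_init)+

text \<open>A Markov chain observed only at the times \<open>\<phi> 0, \<dots>, \<phi> k\<close> is a Markov chain. Times may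
  repeat: the kernel between equal times is the point mass. The induction removes the last
  observation by a jump from \<open>\<phi> k\<close> to \<open>\<phi> (Suc k)\<close>.\<close>

lemma nn_integral_coarsen:
  assumes "mono_on {..k} \<phi>" "\<phi> 0 = 0" "\<phi> k \<le> n" and f: "f \<in> borel_measurable path_space"
  shows "(\<integral>\<^sup>+x. f (stop_path k (x \<circ> \<phi>)) \<partial>chain_law \<mu> P (\<phi> k)) =
    (\<integral>\<^sup>+x. f x \<partial>chain_law \<mu> (\<lambda>i j. P (\<phi> i) (\<phi> j)) k)"
  using assms
proof (induction k arbitrary: f)
  case 0
  have "f (stop_path 0 (((\<lambda>_. 0)(0 := x)) \<circ> \<phi>)) = f ((\<lambda>_. 0)(0 := x))" for x
    using 0 by (intro arg_cong[of _ _ f]) (auto simp: stop_path_def)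
  moreover have "(\<lambda>x. f (stop_path 0 (x \<circ> \<phi>))) \<in> borel_measurable path_space"
    by (rule measurable_compose[OF _ 0(4)], rule measurable_compose[OF _ measurable_stop_path],
        rule measurable_into_path_space) (simp add: measurable_path_component)
  note nn_integral_chain_law_0[OF this]
  moreover have "(\<integral>\<^sup>+x. f x \<partial>chain_law \<mu> (\<lambda>i j. P (\<phi> i) (\<phi> j)) 0) =
      (\<integral>\<^sup>+x. f ((\<lambda>_. 0)(0 := x)) \<partial>\<mu>)"
    using nn_integral_chain_law_0[OF 0(4)] unfolding chain_law.simps .
  ultimately show ?case by (simp only: 0(2))
next
  case (Suc k)
  have le: "\<phi> k \<le> \<phi> (Suc k)"
    by (rule mono_onD[OF Suc.prems(1)]) auto
  have mono: "mono_on {..k} \<phi>" by (rule mono_on_subset[OF Suc.prems(1)]) auto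
  have sub: "\<phi> j \<le> \<phi> k" if "j \<le> k" for j by (rule mono_onD[OF mono]) (use that in auto)
  have incr: "\<phi> i \<le> \<phi> j" if "i \<le> j" "j \<le> Suc k" for i j
    by (rule mono_onD[OF Suc.prems(1)]) (use that in auto)
  have bound: "\<phi> i \<le> n" if "i \<le> Suc k" for i
    using incr[of i "Suc k"] that Suc.prems(3) by auto
  define F where "F x y = f ((stop_path k (x \<circ> \<phi>))(Suc k := y))" for x y
  define g where "g x = (\<integral>\<^sup>+y. f (x(Suc k := y)) \<partial>P (\<phi> k) (\<phi> (Suc k)) (x k))" for x
  have comp: "(\<lambda>x. stop_path k (x \<circ> \<phi>)) \<in> path_space \<rightarrow>\<^sub>M path_space"
    by (rule measurable_compose[OF _ measurable_stop_path],
        rule measurable_into_path_space) (simp add: measurable_path_component)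
  have F: "case_prod F \<in> borel_measurable (path_space \<Otimes>\<^sub>M borel)"
    unfolding F_def case_prod_unfold
    by (rule measurable_compose[OF _ Suc.prems(4)], rule measurable_path_upd,
        rule measurable_compose[OF measurable_fst comp], rule measurable_snd)
  have g: "g \<in> borel_measurable path_space"
    unfolding g_def
  proof (rule measurable_integral_kernel)
    show "(\<lambda>(x, y). f (x(Suc k := y))) \<in> borel_measurable (path_space \<Otimes>\<^sub>M borel)"
      unfolding case_prod_unfold
      by (rule measurable_compose[OF _ Suc.prems(4)], rule measurable_path_upd,
          rule measurable_fst, rule measurable_snd)
  qed (use le Suc.prems in auto)
  have "stop_path k (stop_path (\<phi> k) x \<circ> \<phi>) = stop_path k (x \<circ> \<phi>)" for x
    by (rule ext) (simp add: stop_path_def sub)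
  then have F1: "F (stop_path (\<phi> k) x) y = F x y" for x y
    unfolding F_def by simp
  have "stop_path (Suc k) (x \<circ> \<phi>) = (stop_path k (x \<circ> \<phi>))(Suc k := x (\<phi> (Suc k)))" for x
    by (rule ext) (simp add: stop_path_def le_Suc_eq)
  then have F2: "f (stop_path (Suc k) (x \<circ> \<phi>)) = F (stop_path (\<phi> k) x) (x (\<phi> (Suc k)))" for x
    unfolding F1 unfolding F_def by simp
  have F3: "(\<integral>\<^sup>+y. F x y \<partial>P (\<phi> k) (\<phi> (Suc k)) (x (\<phi> k))) = g (stop_path k (x \<circ> \<phi>))" for x
    unfolding F_def g_def by (simp add: stop_path_def)
  have "(\<integral>\<^sup>+x. f (stop_path (Suc k) (x \<circ> \<phi>)) \<partial>chain_law \<mu> P (\<phi> (Suc k))) =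
      (\<integral>\<^sup>+x. g (stop_path k (x \<circ> \<phi>)) \<partial>chain_law \<mu> P (\<phi> k))"
    using nn_integral_jump[OF _ F, of "\<phi> k" "\<phi> (Suc k) - \<phi> k"] le Suc.prems
    by (simp add: F2 F3 F1)
  also have "\<dots> = (\<integral>\<^sup>+x. g x \<partial>chain_law \<mu> (\<lambda>i j. P (\<phi> i) (\<phi> j)) k)"
    by (rule Suc.IH[OF mono Suc.prems(2) bound g]) simp
  also have "\<dots> = (\<integral>\<^sup>+x. f x \<partial>chain_law \<mu> (\<lambda>i j. P (\<phi> i) (\<phi> j)) (Suc k))"
  proof -
    interpret C: inhomogeneous_chain \<mu> "\<lambda>i j. P (\<phi> i) (\<phi> j)" "Suc k"
      by (rule coarsen_chain[OF Suc.prems(1,3)])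
    show ?thesis
      unfolding g_def by (rule C.nn_integral_chain_law_Suc[OF order_refl Suc.prems(4), symmetric])
  qed
  finally show ?case .
qed

lemma measurable_coarsen: "(\<lambda>x. stop_path k (x \<circ> \<phi>)) \<in> path_space \<rightarrow>\<^sub>M path_space"
  by (rule measurable_compose[OF _ measurable_stop_path],
      rule measurable_into_path_space) (simp add: measurable_path_component)

lemma distr_coarsen:
  assumes "mono_on {..k} \<phi>" "\<phi> 0 = 0" "\<phi> k \<le> n"
  shows "distr (chain_law \<mu> P n) path_space (\<lambda>x. stop_path k (x \<circ> \<phi>)) =
    chain_law \<mu> (\<lambda>i j. P (\<phi> i) (\<phi> j)) k"
proof (rule measure_eqI)
  interpret C: inhomogeneous_chain \<mu> "\<lambda>i j. P (\<phi> i) (\<phi> j)" k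
    by (rule coarsen_chain[OF assms(1,3)])
  note sets_C = C.chain_law_props(2)[OF order_refl]
  show "sets (distr (chain_law \<mu> P n) path_space (\<lambda>x. stop_path k (x \<circ> \<phi>))) =
      sets (chain_law \<mu> (\<lambda>i j. P (\<phi> i) (\<phi> j)) k)"
    unfolding sets_C by simp
  fix X assume "X \<in> sets (distr (chain_law \<mu> P n) path_space (\<lambda>x. stop_path k (x \<circ> \<phi>)))"
  then have X: "X \<in> sets path_space" by simp
  define f :: "(nat \<Rightarrow> real) \<Rightarrow> ennreal" where "f = indicator X"
  have f: "f \<in> borel_measurable path_space" unfolding f_def using X by (rule borel_measurable_indicator)
  have F: "(\<lambda>x. f (stop_path k (x \<circ> \<phi>))) \<in> borel_measurable path_space"
    by (rule measurable_compose[OF measurable_coarsen f])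
  have "\<phi> j \<le> \<phi> k" if "j \<le> k" for j by (rule mono_onD[OF assms(1)]) (use that in auto)
  then have "stop_path k (stop_path (\<phi> k) x \<circ> \<phi>) = stop_path k (x \<circ> \<phi>)" for x
    by (intro ext) (simp add: stop_path_def)
  then have "(\<integral>\<^sup>+x. f (stop_path k (x \<circ> \<phi>)) \<partial>chain_law \<mu> P n) =
      (\<integral>\<^sup>+x. f (stop_path k (x \<circ> \<phi>)) \<partial>chain_law \<mu> P (\<phi> k))"
    using nn_integral_stop[OF assms(3) order_refl F] by (simp only:)
  also have "\<dots> = (\<integral>\<^sup>+x. f x \<partial>chain_law \<mu> (\<lambda>i j. P (\<phi> i) (\<phi> j)) k)"
    by (rule nn_integral_coarsen[OF assms f])
  also have "\<dots> = emeasure (chain_law \<mu> (\<lambda>i j. P (\<phi> i) (\<phi> j)) k) X"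
    unfolding f_def by (rule nn_integral_indicator) (use X sets_C in simp)
  finally have "(\<integral>\<^sup>+x. f (stop_path k (x \<circ> \<phi>)) \<partial>chain_law \<mu> P n) =
    emeasure (chain_law \<mu> (\<lambda>i j. P (\<phi> i) (\<phi> j)) k) X" .
  moreover have "(\<integral>\<^sup>+x. f x \<partial>distr (chain_law \<mu> P n) path_space (\<lambda>x. stop_path k (x \<circ> \<phi>))) =
      (\<integral>\<^sup>+x. f (stop_path k (x \<circ> \<phi>)) \<partial>chain_law \<mu> P n)"
  proof (rule nn_integral_distr)
    show "(\<lambda>x. stop_path k (x \<circ> \<phi>)) \<in> chain_law \<mu> P n \<rightarrow>\<^sub>M path_space"
      unfolding measurable_chain_law[OF order_refl] by (rule measurable_coarsen)
  qed (use f in simp)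
  moreover have "(\<integral>\<^sup>+x. f x \<partial>distr (chain_law \<mu> P n) path_space (\<lambda>x. stop_path k (x \<circ> \<phi>))) =
      emeasure (distr (chain_law \<mu> P n) path_space (\<lambda>x. stop_path k (x \<circ> \<phi>))) X"
    unfolding f_def by (rule nn_integral_indicator) (use X in simp)
  ultimately show "emeasure (distr (chain_law \<mu> P n) path_space (\<lambda>x. stop_path k (x \<circ> \<phi>))) X =
      emeasure (chain_law \<mu> (\<lambda>i j. P (\<phi> i) (\<phi> j)) k) X"
    by (simp only:)
qed

end

section \<open>Consistent orderings of finite semilattices\<close>

locale indexing =
  fixes \<A> :: "'t::t2_space set set"
  assumes indexing_collection: "indexing_collection \<A>"
begin

lemma Inter_in: "F \<subseteq> \<A> \<Longrightarrow> \<Inter>F \<in> \<A>"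
  using indexing_collection by (auto simp: indexing_collection_def)

lemma empty_in: "{} \<in> \<A>"
  using indexing_collection by (auto simp: indexing_collection_def)

lemma min_set_in: "min_set \<A> \<in> \<A>"
  unfolding min_set_def by (rule Inter_in) auto

lemma min_set_subset: "A \<in> \<A> \<Longrightarrow> A \<noteq> {} \<Longrightarrow> min_set \<A> \<subseteq> A"
  unfolding min_set_def by auto

lemma finite_Inter_nonempty:
  assumes "finite F" "F \<subseteq> \<A> - {{}}"
  shows "\<Inter>F \<noteq> {}"
  using assms
proof (induction F rule: finite_induct)
  case (insert A F)
  then have "\<Inter>F \<in> \<A>" "\<Inter>F \<noteq> {}" "A \<in> \<A>" "A \<noteq> {}" by (auto intro!: Inter_in)
  then have "A \<inter> \<Inter>F \<noteq> {}"
    using indexing_collection unfolding indexing_collection_def by blast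
  then show ?case by simp
qed simp

text \<open>Finitely many non-empty sets of \<open>\<A>\<close> meet; compactness passes this on to all of them.\<close>

lemma min_set_nonempty: "min_set \<A> \<noteq> {}"
proof -
  have "UNIV \<inter> \<Inter>(\<A> - {{}}) \<noteq> {}"
  proof (rule compact_imp_fip)
    show "compact (UNIV :: 't set)"
      using indexing_collection by (simp add: indexing_collection_def)
    show "closed T" if "T \<in> \<A> - {{}}" for T
      using that indexing_collection by (auto simp: indexing_collection_def)
    show "UNIV \<inter> \<Inter>F \<noteq> {}" if "finite F" "F \<subseteq> \<A> - {{}}" for F
      using finite_Inter_nonempty[OF that] by simp
  qed
  then show ?thesis by (simp add: min_set_def)
qed

text \<open>The set \<open>min_set \<A>\<close> is included so that every non-empty finite union of sets of \<open>\<A>\<close> has a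
  member of the semilattice inside it.\<close>

lemma finite_subsemilattice_generated:
  assumes "finite F" "F \<subseteq> \<A> - {{}}"
  obtains S where "finite_subsemilattice \<A> S" "F \<subseteq> S" "min_set \<A> \<in> S"
proof -
  let ?F = "insert (min_set \<A>) F"
  let ?S = "Inter ` (Pow ?F - {{}})"
  have sub: "?F \<subseteq> \<A> - {{}}" using assms min_set_in min_set_nonempty by auto
  have in_S: "A \<in> ?S" if "A \<in> ?F" for A
    by (rule image_eqI[of _ _ "{A}"]) (use that in auto)
  have "finite_subsemilattice \<A> ?S"
    unfolding finite_subsemilattice_def
  proof (intro conjI ballI)
    show "finite ?S" using assms by auto
    show "?S \<noteq> {}" using in_S[of "min_set \<A>"] by auto
    show "?S \<subseteq> \<A>" using sub Inter_in by blast
    show "{} \<notin> ?S"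
    proof
      assume "{} \<in> ?S"
      then obtain G where "G \<subseteq> ?F" "\<Inter>G = {}" by auto
      moreover from this assms have "finite G" by (meson finite.insertI finite_subset)
      ultimately show False using finite_Inter_nonempty[of G] sub by blast
    qed
    fix A B assume "A \<in> ?S" "B \<in> ?S"
    then obtain G H where "G \<subseteq> ?F" "G \<noteq> {}" "A = \<Inter>G" "H \<subseteq> ?F" "B = \<Inter>H" by auto
    then show "A \<inter> B \<in> ?S"
      by (intro image_eqI[of _ _ "G \<union> H"]) auto
  qed
  moreover have "F \<subseteq> ?S" using in_S by blast
  moreover have "min_set \<A> \<in> ?S" by (rule in_S) simp
  ultimately show ?thesis by (rule that)
qed

end

lemma finite_subsemilattice_Inter:
  assumes "finite_subsemilattice \<A> S" "finite F" "F \<noteq> {}" "F \<subseteq> S"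
  shows "\<Inter>F \<in> S"
  using assms(2-)
proof (induction F rule: finite_ne_induct)
  case (insert A F)
  then have "A \<in> S" "\<Inter>F \<in> S" by auto
  then have "A \<inter> \<Inter>F \<in> S"
    using assms(1) unfolding finite_subsemilattice_def by blast
  then show ?case by simp
qed simp

lemma consistent_ordering_bij:
  assumes "consistent_ordering \<A> S n A"
  shows "A ` {1..n} = S" "inj_on A {1..n}" "n = card S"
  using assms bij_betw_same_card[of A "{1..n}" S]
  by (auto simp: consistent_ordering_def bij_betw_def)

lemma consistent_ordering_le:
  assumes A: "consistent_ordering \<A> S n A" and ij: "i \<in> {1..n}" "j \<in> {1..n}" and "A i \<subseteq> A j"
  shows "i \<le> j"
proof (cases "A i = A j")
  case True
  then show ?thesis
    using inj_onD[OF consistent_ordering_bij(2)[OF A]] ij by auto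
next
  case False
  obtain k where k: "j = Suc k" "k < n" using ij by (cases j) auto
  have "A i \<in> S" using consistent_ordering_bij(1)[OF A] ij by auto
  then have "A i \<in> A ` {1..k}"
    using A k False \<open>A i \<subseteq> A j\<close> unfolding consistent_ordering_def by blast
  then obtain l where "l \<in> {1..k}" "A i = A l" by auto
  then show ?thesis
    using inj_onD[OF consistent_ordering_bij(2)[OF A], of i l] ij k by auto
qed

text \<open>Consistent orderings can be refined along any monotone key \<open>b\<close>: sort by \<open>b\<close>, and break ties by
  the number of members below a set. The second criterion is strictly monotone under proper inclusion,
  which makes the ordering consistent. The key makes it possible to put chosen blocks of sets first.\<close>

lemma consistent_ordering_exists:
  fixes b :: "'t set \<Rightarrow> nat"
  assumes S: "finite_subsemilattice \<A> S"
    and b: "\<And>D E. D \<in> S \<Longrightarrow> E \<in> S \<Longrightarrow> D \<subseteq> E \<Longrightarrow> b D \<le> b E"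
  obtains A where "consistent_ordering \<A> S (card S) A" "mono_on {1..card S} (b \<circ> A)"
proof -
  have fin: "finite S" using S by (simp add: finite_subsemilattice_def)
  define N where "N = Suc (card S)"
  define f where "f D = b D * N + card {E\<in>S. E \<subseteq> D}" for D
  have small: "card {E\<in>S. E \<subseteq> D} < N" for D
    using card_mono[OF fin, of "{E\<in>S. E \<subseteq> D}"] by (auto simp: N_def)
  have f_strict: "f D < f E" if "D \<in> S" "E \<in> S" "D \<subset> E" for D E
  proof -
    have "card {F\<in>S. F \<subseteq> D} < card {F\<in>S. F \<subseteq> E}"
      by (rule psubset_card_mono) (use fin that in auto)
    moreover have "b D * N \<le> b E * N" using b[of D E] that by auto
    ultimately show ?thesis unfolding f_def by linarith
  qed
  have f_le: "b D \<le> b E" if "f D \<le> f E" for D E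
  proof (rule ccontr)
    assume "\<not> b D \<le> b E"
    then have "Suc (b E) * N \<le> b D * N" by (intro mult_le_mono1) simp
    then have "b E * N + N \<le> b D * N" by simp
    then show False using small[of E] that unfolding f_def by linarith
  qed
  obtain xs where xs: "set xs = S" "distinct xs" using finite_distinct_list[OF fin] by auto
  define ys where "ys = sort_key f xs"
  have ys: "set ys = S" "distinct ys" "sorted (map f ys)" "length ys = card S"
    using xs distinct_card[OF xs(2)] by (auto simp: ys_def)
  have sorted: "f (ys ! i) \<le> f (ys ! j)" if "i \<le> j" "j < card S" for i j
    using sorted_nth_mono[OF ys(3), of i j] that ys(4) by simp
  define A where "A i = (if i = 0 then min_set \<A> else ys ! (i - 1))" for i
  have "bij_betw A {1..card S} S"
  proof -
    have "bij_betw (\<lambda>i. i - 1) {1..card S} {..<card S}"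
      by (rule bij_betwI[of _ _ _ Suc]) auto
    moreover have "bij_betw ((!) ys) {..<card S} S"
      using bij_betw_nth[OF ys(2)] ys by auto
    ultimately have "bij_betw ((!) ys \<circ> (\<lambda>i. i - 1)) {1..card S} S"
      by (rule bij_betw_trans)
    then show ?thesis by (rule bij_betw_cong[THEN iffD1, rotated]) (auto simp: A_def)
  qed
  note bij = this
  have mono: "f (A i) \<le> f (A j)" if "i \<in> {1..card S}" "j \<in> {1..card S}" "i \<le> j" for i j
    using sorted[of "i - 1" "j - 1"] that by (auto simp: A_def)
  have pos: "1 \<in> {1..card S}"
    using S fin card_gt_0_iff[of S] by (auto simp: finite_subsemilattice_def)
  have "\<Inter>S \<in> S"
    using finite_subsemilattice_Inter[OF S fin] S by (auto simp: finite_subsemilattice_def)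
  have "A 1 \<in> S" using bij pos by (auto dest: bij_betwE)
  have first: "A 1 = \<Inter>S"
  proof (rule ccontr)
    assume "A 1 \<noteq> \<Inter>S"
    then have "\<Inter>S \<subset> A 1" using \<open>A 1 \<in> S\<close> by auto
    then have "f (\<Inter>S) < f (A 1)" using f_strict \<open>\<Inter>S \<in> S\<close> \<open>A 1 \<in> S\<close> by blast
    moreover obtain i where "i \<in> {1..card S}" "\<Inter>S = A i"
      using bij \<open>\<Inter>S \<in> S\<close> unfolding bij_betw_def by blast
    ultimately show False using mono[of 1 i] pos by auto
  qed
  have "consistent_ordering \<A> S (card S) A"
    unfolding consistent_ordering_def
  proof (intro conjI allI impI ballI)
    show "A 0 = min_set \<A>" by (simp add: A_def)
    show "bij_betw A {1..card S} S" by (rule bij)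
    show "A 1 = \<Inter>S" by (rule first)
    fix i B assume i: "i < card S" and B: "B \<in> S" "B \<subset> A (Suc i)"
    have "A (Suc i) \<in> S" using bij i by (auto dest: bij_betwE)
    obtain j where j: "j \<in> {1..card S}" "B = A j"
      using bij B unfolding bij_betw_def by blast
    have "\<not> Suc i \<le> j"
      using mono[of "Suc i" j] f_strict[OF B(1) \<open>A (Suc i) \<in> S\<close> B(2)] i j by auto
    then show "B \<in> A ` {1..i}" using j by auto
  qed
  moreover have "mono_on {1..card S} (b \<circ> A)"
    by (rule mono_onI) (use mono f_le in auto)
  ultimately show ?thesis by (rule that)
qed

text \<open>The increment at \<open>1\<close> is \<open>x 1\<close> itself, not \<open>x 1 - x 0\<close>: it is the value at \<open>A\<^sub>1\<close>, the
  smallest set, so that the first \<open>k\<close> increments add up to \<open>x k\<close>.\<close>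

definition increment :: "(nat \<Rightarrow> real) \<Rightarrow> nat \<Rightarrow> real" where
  "increment x i = x i - (if i = 1 then 0 else x (i - 1))"

text \<open>Besides members of the ordering, \<open>B\<close> may be a union of members; the sum is then the value at that
  union.\<close>

definition set_value :: "(nat \<Rightarrow> 't set) \<Rightarrow> nat \<Rightarrow> (nat \<Rightarrow> real) \<Rightarrow> 't set \<Rightarrow> real" where
  "set_value A n x B = (\<Sum>i | i \<in> {1..n} \<and> A i \<subseteq> B. increment x i)"

lemma sum_increment: "(\<Sum>i\<in>{1..k}. increment x i) = (if k = 0 then 0 else x k)"
proof (induction k)
  case (Suc k)
  then show ?case by (cases k) (auto simp: increment_def)
qed simp

text \<open>In an ordering sorted by \<open>b\<close>, the sets of key at most \<open>k\<close> occupy the positions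
  \<open>1, \<dots>, block_end S b k\<close>.\<close>

definition block_end :: "'t set set \<Rightarrow> ('t set \<Rightarrow> nat) \<Rightarrow> nat \<Rightarrow> nat" where
  "block_end S b k = card {D\<in>S. b D \<le> k}"

lemma block_end_mono: "finite S \<Longrightarrow> j \<le> k \<Longrightarrow> block_end S b j \<le> block_end S b k"
  unfolding block_end_def by (rule card_mono) auto

lemma block_end_le: "finite S \<Longrightarrow> block_end S b k \<le> card S"
  unfolding block_end_def by (rule card_mono) auto

lemma block_indices:
  assumes A: "consistent_ordering \<A> S n A" and b: "mono_on {1..n} (b \<circ> A)"
  shows "{i\<in>{1..n}. b (A i) \<le> k} = {1..block_end S b k}"
proof -
  let ?I = "{i\<in>{1..n}. b (A i) \<le> k}"
  have "card ?I = card (A ` ?I)"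
    by (rule card_image[symmetric], rule inj_on_subset[OF consistent_ordering_bij(2)[OF A]]) auto
  also have "A ` ?I = {D\<in>S. b D \<le> k}"
    using consistent_ordering_bij(1)[OF A] by auto
  finally have card: "card ?I = block_end S b k" unfolding block_end_def .
  have down: "j \<in> ?I" if "i \<in> ?I" "1 \<le> j" "j \<le> i" for i j
    using mono_onD[OF b, of j i] that by auto
  have "?I = {1..card ?I}"
  proof (cases "?I = {}")
    case False
    define m where "m = Max ?I"
    have "finite ?I" by simp
    then have m: "m \<in> ?I" "\<And>i. i \<in> ?I \<Longrightarrow> i \<le> m"
      using False Max_in[of ?I] Max_ge[of ?I] unfolding m_def by blast+
    have "?I = {1..m}"
    proof (intro equalityI subsetI)
      fix i assume "i \<in> ?I"
      then show "i \<in> {1..m}" using m(2)[of i] by simp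
    next
      fix i assume "i \<in> {1..m}"
      then show "i \<in> ?I" using down[OF m(1), of i] by simp
    qed
    moreover from this have "card ?I = m" by (metis card_atLeastAtMost diff_Suc_1)
    ultimately show ?thesis by (simp only:)
  qed simp
  then show ?thesis by (simp only: card)
qed

lemma (in indexing) Union_block:
  assumes S: "finite_subsemilattice \<A> S" and A: "consistent_ordering \<A> S n A"
    and b: "mono_on {1..n} (b \<circ> A)"
  shows "(\<Union>j\<le>block_end S b k. A j) = min_set \<A> \<union> \<Union>{D\<in>S. b D \<le> k}"
proof -
  have "{..block_end S b k} = insert 0 {i\<in>{1..n}. b (A i) \<le> k}"
    unfolding block_indices[OF A b] by auto
  moreover have "A ` {i\<in>{1..n}. b (A i) \<le> k} = {D\<in>S. b D \<le> k}"
    using consistent_ordering_bij(1)[OF A] by auto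
  moreover have "A 0 = min_set \<A>" using A by (simp add: consistent_ordering_def)
  ultimately show ?thesis by simp
qed

lemma sum_increment_block:
  assumes A: "consistent_ordering \<A> S n A" and b: "mono_on {1..n} (b \<circ> A)"
    and "block_end S b k \<noteq> 0"
  shows "(\<Sum>i | i \<in> {1..n} \<and> b (A i) \<le> k. increment x i) = x (block_end S b k)"
  using block_indices[OF A b, of k] sum_increment[of x "block_end S b k"] assms(3) by simp

text \<open>The key of \<open>D \<in> S'\<close> is the first position \<open>k\<close> with \<open>D \<subseteq> A k\<close>, or \<open>Suc n\<close> if there is
  none; \<open>\<phi> k\<close> is the end of the \<open>k\<close>-th block. The point of this key is that a set \<open>D\<close> lies
  inside a member \<open>B\<close> of \<open>S\<close> exactly if the set \<open>A (b D)\<close> that names its block does: the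
  intersection of \<open>A (b D)\<close> with \<open>B\<close> is a member of \<open>S\<close> that contains \<open>D\<close>, so it cannot come
  before \<open>A (b D)\<close>. Hence the increments inside \<open>B\<close> form whole blocks, and each block telescopes
  to an increment of the coarser chain.\<close>

lemma (in indexing) refine_ordering:
  assumes S: "finite_subsemilattice \<A> S" and S': "finite_subsemilattice \<A> S'" and sub: "S \<subseteq> S'"
    and A: "consistent_ordering \<A> S n A"
  obtains A' \<phi> where "consistent_ordering \<A> S' (card S') A'"
    and "mono \<phi>" and "\<phi> 0 = 0" and "\<phi> n \<le> card S'"
    and "\<And>k. k \<le> n \<Longrightarrow> (\<Union>j\<le>\<phi> k. A' j) = (\<Union>j\<le>k. A j)"
    and "\<And>x B. B \<in> S \<Longrightarrow>
      set_value A' (card S') x B = set_value A n (stop_path n (x \<circ> \<phi>)) B"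
proof -
  have fin': "finite S'" using S' by (simp add: finite_subsemilattice_def)
  note im = consistent_ordering_bij(1)[OF A]
  have A0: "A 0 = min_set \<A>" using A by (simp add: consistent_ordering_def)
  define ok where "ok D k \<longleftrightarrow> 1 \<le> k \<and> (n < k \<or> D \<subseteq> A k)" for D k
  define b where "b D = (LEAST k. ok D k)" for D
  have "ok D (Suc n)" for D by (simp add: ok_def)
  then have ok: "ok D (b D)" for D unfolding b_def by (rule LeastI)
  have b_le: "b D \<le> k" if "ok D k" for D k unfolding b_def using that by (rule Least_le)
  have mono_b: "b D \<le> b E" if "D \<subseteq> E" for D E
    using ok[of E] that by (intro b_le) (auto simp: ok_def)
  obtain A' where A': "consistent_ordering \<A> S' (card S') A'"
    and mono_A': "mono_on {1..card S'} (b \<circ> A')"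
    using consistent_ordering_exists[OF S', of b] mono_b by blast
  define \<phi> where "\<phi> = block_end S' b"
  have mono: "mono \<phi>" unfolding \<phi>_def by (rule monoI) (rule block_end_mono[OF fin'])
  have zero: "\<phi> 0 = 0"
  proof -
    have "b D \<noteq> 0" for D using ok[of D] by (auto simp: ok_def)
    then have none: "{D\<in>S'. b D \<le> 0} = {}" by simp
    show ?thesis unfolding \<phi>_def block_end_def none by simp
  qed
  have b_A: "b (A k) \<le> k" if "k \<in> {1..n}" for k
    using that by (intro b_le) (auto simp: ok_def)
  have unions: "(\<Union>j\<le>\<phi> k. A' j) = (\<Union>j\<le>k. A j)" if "k \<le> n" for k
  proof -
    have "\<Union>{D\<in>S'. b D \<le> k} = (\<Union>j\<in>{1..k}. A j)"
    proof (intro equalityI subsetI)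
      fix t assume "t \<in> \<Union>{D\<in>S'. b D \<le> k}"
      then obtain D where "D \<in> S'" "b D \<le> k" "t \<in> D" by auto
      then show "t \<in> (\<Union>j\<in>{1..k}. A j)"
        using ok[of D] \<open>k \<le> n\<close> by (auto simp: ok_def)
    next
      fix t assume "t \<in> (\<Union>j\<in>{1..k}. A j)"
      then obtain j where j: "j \<in> {1..k}" "t \<in> A j" by auto
      then have "A j \<in> S'" "b (A j) \<le> k"
        using im sub b_A[of j] \<open>k \<le> n\<close> by auto
      then show "t \<in> \<Union>{D\<in>S'. b D \<le> k}" using j by auto
    qed
    moreover have "{..k} = insert 0 {1..k}" by auto
    ultimately show ?thesis
      unfolding \<phi>_def Union_block[OF S' A' mono_A'] using A0 by auto
  qed
  have on_S: "set_value A' (card S') x B = set_value A n (stop_path n (x \<circ> \<phi>)) B"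
    if B: "B \<in> S" for x B
  proof -
    obtain k where k: "k \<in> {1..n}" "B = A k" using im B by auto
    have sub_iff: "D \<subseteq> B \<longleftrightarrow> b D \<in> {1..n} \<and> A (b D) \<subseteq> B" for D
    proof
      assume "D \<subseteq> B"
      then have "b D \<le> k" using k by (intro b_le) (auto simp: ok_def)
      then have bn: "b D \<in> {1..n}" using ok[of D] k by (auto simp: ok_def)
      then have "A (b D) \<in> S" using im by auto
      then have "A (b D) \<inter> B \<in> S" using S B unfolding finite_subsemilattice_def by blast
      then obtain l where l: "l \<in> {1..n}" "A (b D) \<inter> B = A l" using im by blast
      have "D \<subseteq> A (b D)" using ok[of D] bn by (auto simp: ok_def)
      then have "b D \<le> l" using l \<open>D \<subseteq> B\<close> by (intro b_le) (auto simp: ok_def)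
      moreover have "l \<le> b D" using consistent_ordering_le[OF A l(1) bn] l by auto
      ultimately have "A (b D) \<subseteq> B" using l by auto
      then show "b D \<in> {1..n} \<and> A (b D) \<subseteq> B" using bn by simp
    next
      assume "b D \<in> {1..n} \<and> A (b D) \<subseteq> B"
      then show "D \<subseteq> B" using ok[of D] by (auto simp: ok_def)
    qed
    \<comment> \<open>The first block contains \<open>A 1\<close>, so the later blocks start after position \<open>1\<close> and telescope.\<close>
    have pos: "\<phi> j \<noteq> 0" if "1 \<le> j" for j
    proof -
      have "A 1 \<in> {D\<in>S'. b D \<le> j}"
        using b_A[of 1] k im sub that by (auto intro: order_trans)
      then show ?thesis unfolding \<phi>_def block_end_def using fin' by auto
    qed
    have block_sum: "(\<Sum>i | i \<in> {1..card S'} \<and> b (A' i) = j. increment x i) =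
        increment (stop_path n (x \<circ> \<phi>)) j" if j: "j \<in> {1..n}" for j
    proof -
      have sums: "(\<Sum>i | i \<in> {1..card S'} \<and> b (A' i) \<le> l. increment x i) =
          (if l = 0 then 0 else x (\<phi> l))" for l
      proof (cases "l = 0")
        case True
        then have "{i\<in>{1..card S'}. b (A' i) \<le> l} = {}"
          using block_indices[OF A' mono_A', of l] zero by (simp add: \<phi>_def)
        then show ?thesis using True by (simp only: sum.empty simp_thms if_True)
      next
        case False
        then show ?thesis
          using sum_increment_block[OF A' mono_A', of l] pos[of l] by (simp add: \<phi>_def)
      qed
      define I where "I l = {i. i \<in> {1..card S'} \<and> b (A' i) \<le> l}" for l
      have I: "finite (I j)" "I (j - 1) \<subseteq> I j" by (auto simp: I_def)
      have "{i. i \<in> {1..card S'} \<and> b (A' i) = j} = I j - I (j - 1)"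
        using j by (auto simp: I_def)
      then have "(\<Sum>i | i \<in> {1..card S'} \<and> b (A' i) = j. increment x i) =
          sum (increment x) (I j) - sum (increment x) (I (j - 1))"
        using sum_diff[OF I] by metis
      also have "\<dots> = increment (stop_path n (x \<circ> \<phi>)) j"
        unfolding I_def sums using j by (auto simp: increment_def stop_path_def)
      finally show ?thesis .
    qed
    have "{i. i \<in> {1..card S'} \<and> A' i \<subseteq> B} =
        (\<Union>j\<in>{j\<in>{1..n}. A j \<subseteq> B}. {i. i \<in> {1..card S'} \<and> b (A' i) = j})"
      (is "?L = ?R")
    proof (rule set_eqI)
      fix i show "i \<in> ?L \<longleftrightarrow> i \<in> ?R" using sub_iff[of "A' i"] by blast
    qed
    then have "set_value A' (card S') x B =
        (\<Sum>i\<in>(\<Union>j\<in>{j\<in>{1..n}. A j \<subseteq> B}. {i. i \<in> {1..card S'} \<and> b (A' i) = j}). increment x i)"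
      unfolding set_value_def by (rule sum.cong) (rule refl)
    also have "\<dots> = (\<Sum>j\<in>{j\<in>{1..n}. A j \<subseteq> B}.
        \<Sum>i | i \<in> {1..card S'} \<and> b (A' i) = j. increment x i)"
      by (rule sum.UNION_disjoint) auto
    also have "\<dots> = set_value A n (stop_path n (x \<circ> \<phi>)) B"
      unfolding set_value_def by (rule sum.cong) (use block_sum in auto)
    finally show ?thesis .
  qed
  have "\<phi> n \<le> card S'" unfolding \<phi>_def by (rule block_end_le[OF fin'])
  then show ?thesis by (rule that[OF A' mono zero _ unions on_S])
qed

section \<open>Finite-dimensional laws\<close>

lemma chain_law_cong:
  "(\<And>i. i < n \<Longrightarrow> P i (Suc i) = P' i (Suc i)) \<Longrightarrow> chain_law \<mu> P n = chain_law \<mu> P' n"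
  by (induction n) auto

locale consistent_transition_system = indexing \<A>
  for \<A> :: "'t::t2_space set set" +
  fixes \<mu> :: "real measure"
    and Q :: "'t set \<Rightarrow> 't set \<Rightarrow> real \<Rightarrow> real measure"
  assumes prob_init: "prob_space \<mu>" and sets_init: "sets \<mu> = sets borel"
    and transition_system: "transition_system \<A> Q"
    and consistency: "\<And>\<A>' n A A' \<pi> \<Gamma>.
      finite_subsemilattice \<A> \<A>' \<Longrightarrow>
      consistent_ordering \<A> \<A>' n A \<Longrightarrow>
      consistent_ordering \<A> \<A>' n A' \<Longrightarrow>
      \<pi> permutes {1..n} \<Longrightarrow> \<pi> 1 = 1 \<Longrightarrow> (\<forall>i\<in>{1..n}. A i = A' (\<pi> i)) \<Longrightarrow>
      (\<forall>i\<le>n. \<Gamma> i \<in> sets (borel :: real measure)) \<Longrightarrow>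
      path_integral \<mu> Q A n
        (\<lambda>x. indicator (\<Gamma> 0) (x 0) * indicator (\<Gamma> 1) (x 1) *
             (\<Prod>i\<in>{2..n}. indicator (\<Gamma> i) (x i - x (i - 1))))
      = path_integral \<mu> Q A' n
        (\<lambda>y. indicator (\<Gamma> 0) (y 0) * indicator (\<Gamma> 1) (y 1) *
             (\<Prod>i\<in>{2..n}. indicator (\<Gamma> i) (y (\<pi> i) - y (\<pi> i - 1))))"
begin

definition chain_kernel :: "(nat \<Rightarrow> 't set) \<Rightarrow> nat \<Rightarrow> nat \<Rightarrow> real \<Rightarrow> real measure" where
  "chain_kernel A i j = Q (\<Union>l\<le>i. A l) (\<Union>l\<le>j. A l)"

definition path_law :: "(nat \<Rightarrow> 't set) \<Rightarrow> nat \<Rightarrow> (nat \<Rightarrow> real) measure" where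
  "path_law A n = chain_law \<mu> (chain_kernel A) n"

lemma ordering_sets:
  assumes S: "finite_subsemilattice \<A> S" and A: "consistent_ordering \<A> S n A"
  shows "i \<le> n \<Longrightarrow> A i \<in> \<A>" "i \<le> n \<Longrightarrow> A i \<noteq> {}"
    "k \<le> n \<Longrightarrow> (\<Union>l\<le>k. A l) \<in> fin_unions \<A> - {{}}"
proof -
  have *: "A i \<in> \<A> \<and> A i \<noteq> {}" if "i \<le> n" for i
  proof (cases "i = 0")
    case True
    then show ?thesis
      using A min_set_in min_set_nonempty by (simp add: consistent_ordering_def)
  next
    case False
    then have "A i \<in> S" using consistent_ordering_bij(1)[OF A] that by auto
    then show ?thesis using S by (auto simp: finite_subsemilattice_def)
  qed
  then show "i \<le> n \<Longrightarrow> A i \<in> \<A>" "i \<le> n \<Longrightarrow> A i \<noteq> {}" by auto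
  assume k: "k \<le> n"
  have "\<Union>(A ` {..k}) \<in> fin_unions \<A>"
    unfolding fin_unions_def using * k by (intro CollectI exI[of _ "A ` {..k}"]) auto
  moreover have "A 0 \<subseteq> (\<Union>l\<le>k. A l)" by auto
  ultimately show "(\<Union>l\<le>k. A l) \<in> fin_unions \<A> - {{}}" using *[of 0] by auto
qed

lemma ordering_chain:
  assumes S: "finite_subsemilattice \<A> S" and A: "consistent_ordering \<A> S n A"
  shows "inhomogeneous_chain \<mu> (chain_kernel A) n"
proof (rule inhomogeneous_chain.intro)
  note U = ordering_sets(3)[OF S A]
  have mono: "(\<Union>l\<le>i. A l) \<subseteq> (\<Union>l\<le>j. A l)" if "i \<le> j" for i j using that by fastforce
  note T = transition_system[unfolded transition_system_def]
  note T1 = T[THEN conjunct1] and T2 = T[THEN conjunct2, THEN conjunct1]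
    and T3 = T[THEN conjunct2, THEN conjunct2]
  show "chain_kernel A i j \<in> borel \<rightarrow>\<^sub>M prob_algebra borel" if "i \<le> j" "j \<le> n" for i j
    unfolding chain_kernel_def
    by (rule T1[rule_format, OF U U mono]) (use that in auto)
  show "chain_kernel A i i x = return borel x" if "i \<le> n" for i x
    unfolding chain_kernel_def by (rule T2[rule_format, OF U]) (use that in auto)
  show "emeasure (chain_kernel A i k x) \<Gamma> = (\<integral>\<^sup>+y. emeasure (chain_kernel A j k y) \<Gamma> \<partial>chain_kernel A i j x)"
    if "i \<le> j" "j \<le> k" "k \<le> n" "\<Gamma> \<in> sets borel" for i j k x \<Gamma>
    unfolding chain_kernel_def
    by (rule T3[rule_format, OF U U U mono mono]) (use that in auto)
qed (fact prob_init sets_init)+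

lemma path_integral_eq:
  assumes S: "finite_subsemilattice \<A> S" and A: "consistent_ordering \<A> S n A"
    and "m \<le> n" and "f \<in> borel_measurable path_space"
  shows "path_integral \<mu> Q A m f = (\<integral>\<^sup>+x. f x \<partial>chain_law \<mu> (chain_kernel A) m)"
proof -
  interpret inhomogeneous_chain \<mu> "chain_kernel A" n by (rule ordering_chain[OF S A])
  show ?thesis
    using assms(3,4)
  proof (induction m arbitrary: f)
    case 0
    show ?case
      unfolding path_integral.simps nn_integral_chain_law_0[OF 0(2)] by (rule refl)
  next
    case (Suc m)
    have "(\<lambda>x. \<integral>\<^sup>+y. f (x(Suc m := y)) \<partial>chain_kernel A m (Suc m) (x m)) \<in> borel_measurable path_space"
    proof (rule measurable_integral_kernel)
      show "(\<lambda>(x, y). f (x(Suc m := y))) \<in> borel_measurable (path_space \<Otimes>\<^sub>M borel)"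
        unfolding case_prod_unfold
        by (rule measurable_compose[OF _ Suc.prems(2)],
            rule measurable_path_upd[OF measurable_fst measurable_snd])
    qed (use Suc.prems in auto)
    from Suc.IH[OF Suc_leD[OF Suc.prems(1)] this] show ?case
      unfolding path_integral.simps nn_integral_chain_law_Suc[OF Suc.prems]
      unfolding chain_kernel_def .
  qed
qed

lemma measurable_path_law:
  assumes S: "finite_subsemilattice \<A> S" and A: "consistent_ordering \<A> S n A"
  shows "measurable (path_law A n) N = measurable path_space N"
proof -
  interpret inhomogeneous_chain \<mu> "chain_kernel A" n by (rule ordering_chain[OF S A])
  show ?thesis unfolding path_law_def by (rule measurable_chain_law[OF order_refl])
qed

lemma prob_space_path_law:
  assumes S: "finite_subsemilattice \<A> S" and A: "consistent_ordering \<A> S n A"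
  shows "prob_space (path_law A n)"
proof -
  interpret inhomogeneous_chain \<mu> "chain_kernel A" n by (rule ordering_chain[OF S A])
  show ?thesis unfolding path_law_def by (rule chain_law_props(1)[OF order_refl])
qed

lemma measurable_increment [measurable]: "(\<lambda>x. increment x i) \<in> borel_measurable path_space"
  unfolding increment_def by simp

lemma measurable_set_value [measurable]: "(\<lambda>x. set_value A n x B) \<in> borel_measurable path_space"
  unfolding set_value_def by measurable

text \<open>The joint law of the values at the sets of \<open>J\<close>, computed from one ordering of a semilattice that
  contains \<open>J\<close>.\<close>

definition joint_law :: "(nat \<Rightarrow> 't set) \<Rightarrow> nat \<Rightarrow> 't set set \<Rightarrow> ('t set \<Rightarrow> real) measure" where
  "joint_law A n J =
    distr (path_law A n) (PiM J (\<lambda>_. borel)) (\<lambda>x. \<lambda>B\<in>J. set_value A n x B)"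

lemma measurable_set_values:
  "(\<lambda>x. \<lambda>B\<in>J. set_value A n x B) \<in> path_space \<rightarrow>\<^sub>M PiM J (\<lambda>_. borel)"
  by (rule measurable_restrict) measurable

text \<open>The consistency condition is this statement tested on products of Borel sets, and such products
  determine the law. The condition uses the test sets by position; setting the test set for position
  \<open>i\<close> to \<open>\<Gamma> (A i)\<close> and that for \<open>x 0\<close> to the whole line relabels them by the members
  of \<open>S\<close>.\<close>

lemma increments_permute:
  assumes S: "finite_subsemilattice \<A> S" and A: "consistent_ordering \<A> S n A"
    and A': "consistent_ordering \<A> S n A'"
  shows "distr (path_law A n) (PiM S (\<lambda>_. borel)) (\<lambda>x. \<lambda>D\<in>S. increment x (inv_into {1..n} A D)) =
    distr (path_law A' n) (PiM S (\<lambda>_. borel)) (\<lambda>x. \<lambda>D\<in>S. increment x (inv_into {1..n} A' D))"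
    (is "?L = ?R")
proof (rule measure_eqI_PiM_finite)
  have fin: "finite S" using S by (simp add: finite_subsemilattice_def)
  show "finite S" by (rule fin)
  show "sets ?L = sets (PiM S (\<lambda>_. borel))" "sets ?R = sets (PiM S (\<lambda>_. borel))" by simp_all
  interpret P: prob_space "path_law A n" by (rule prob_space_path_law[OF S A])
  have n: "1 \<in> {1..n}"
    using S consistent_ordering_bij(3)[OF A] card_gt_0_iff[of S]
    by (auto simp: finite_subsemilattice_def)
  have meas: "(\<lambda>x. \<lambda>D\<in>S. increment x (g D)) \<in> path_space \<rightarrow>\<^sub>M PiM S (\<lambda>_. borel)" for g
    by (rule measurable_restrict) measurable
  show "range (\<lambda>i::nat. space (PiM S (\<lambda>_. borel :: real measure))) \<subseteq> prod_algebra S (\<lambda>_. borel)"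
    using prod_algebraI_finite[OF fin, of "\<lambda>_. UNIV" "\<lambda>_. borel"] by (auto simp: space_PiM)
  show "(\<Union>i::nat. space (PiM S (\<lambda>_. borel :: real measure))) = space (PiM S (\<lambda>_. borel))" by simp
  have "prob_space ?L"
  proof (rule P.prob_space_distr)
    show "(\<lambda>x. \<lambda>D\<in>S. increment x (inv_into {1..n} A D)) \<in> path_law A n \<rightarrow>\<^sub>M PiM S (\<lambda>_. borel)"
      unfolding measurable_path_law[OF S A] by (rule meas)
  qed
  then show "emeasure ?L (space (PiM S (\<lambda>_. borel))) \<noteq> \<infinity>" for i :: nat
    using prob_space.emeasure_space_1[of ?L] by simp
  fix \<Gamma> :: "'t set \<Rightarrow> real set" assume \<Gamma>: "\<And>i. i \<in> S \<Longrightarrow> \<Gamma> i \<in> sets borel"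
  have rect: "emeasure (distr (path_law B n) (PiM S (\<lambda>_. borel))
        (\<lambda>x. \<lambda>D\<in>S. increment x (inv_into {1..n} B D))) (Pi\<^sub>E S \<Gamma>) =
      path_integral \<mu> Q B n (\<lambda>x. \<Prod>i\<in>{1..n}. indicator (\<Gamma> (B i)) (increment x i))"
    if B: "consistent_ordering \<A> S n B" for B
  proof -
    have bij: "bij_betw B {1..n} S" using B by (simp add: consistent_ordering_def)
    have ind: "indicator (Pi\<^sub>E S \<Gamma>) (\<lambda>D\<in>S. increment x (inv_into {1..n} B D)) =
        (\<Prod>i\<in>{1..n}. indicator (\<Gamma> (B i)) (increment x i) :: ennreal)" for x
    proof -
      have "indicator (Pi\<^sub>E S \<Gamma>) (\<lambda>D\<in>S. increment x (inv_into {1..n} B D)) =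
          (\<Prod>D\<in>S. indicator (\<Gamma> D) (increment x (inv_into {1..n} B D)) :: ennreal)"
        using fin by (auto simp: indicator_def PiE_iff)
      also have "\<dots> = (\<Prod>i\<in>{1..n}. indicator (\<Gamma> (B i)) (increment x (inv_into {1..n} B (B i))))"
        by (rule prod.reindex_bij_betw[OF bij, symmetric])
      also have "\<dots> = (\<Prod>i\<in>{1..n}. indicator (\<Gamma> (B i)) (increment x i))"
        by (rule prod.cong) (use bij in \<open>auto simp: bij_betw_def\<close>)
      finally show ?thesis .
    qed
    have \<Gamma>B: "\<Gamma> (B i) \<in> sets borel" if "i \<in> {1..n}" for i
      using \<Gamma> bij_betwE[OF bij] that by auto
    have meas': "(\<lambda>x. \<Prod>i\<in>{1..n}. indicator (\<Gamma> (B i)) (increment x i) :: ennreal)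
        \<in> borel_measurable path_space"
      by (intro borel_measurable_prod_ennreal measurable_compose[OF measurable_increment]
          borel_measurable_indicator \<Gamma>B)
    have rect_sets: "Pi\<^sub>E S \<Gamma> \<in> sets (PiM S (\<lambda>_. borel))"
      using fin \<Gamma> by (intro sets_PiM_I_finite) auto
    have "emeasure (distr (path_law B n) (PiM S (\<lambda>_. borel))
        (\<lambda>x. \<lambda>D\<in>S. increment x (inv_into {1..n} B D))) (Pi\<^sub>E S \<Gamma>) =
        (\<integral>\<^sup>+z. indicator (Pi\<^sub>E S \<Gamma>) z \<partial>distr (path_law B n) (PiM S (\<lambda>_. borel))
        (\<lambda>x. \<lambda>D\<in>S. increment x (inv_into {1..n} B D)))"
      by (rule nn_integral_indicator[symmetric]) (use rect_sets in simp)
    also have "\<dots> = (\<integral>\<^sup>+x. indicator (Pi\<^sub>E S \<Gamma>) (\<lambda>D\<in>S. increment x (inv_into {1..n} B D))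
        \<partial>path_law B n)"
    proof (rule nn_integral_distr)
      show "(\<lambda>x. \<lambda>D\<in>S. increment x (inv_into {1..n} B D)) \<in> path_law B n \<rightarrow>\<^sub>M PiM S (\<lambda>_. borel)"
        unfolding measurable_path_law[OF S B] by (rule meas)
    qed (use rect_sets in auto)
    also have "\<dots> = path_integral \<mu> Q B n (\<lambda>x. \<Prod>i\<in>{1..n}. indicator (\<Gamma> (B i)) (increment x i))"
      unfolding ind path_law_def by (rule path_integral_eq[OF S B order_refl meas', symmetric])
    finally show ?thesis .
  qed
  define \<pi> where "\<pi> i = (if i \<in> {1..n} then inv_into {1..n} A' (A i) else i)" for i
  have bij: "bij_betw A {1..n} S" "bij_betw A' {1..n} S"
    using A A' by (simp_all add: consistent_ordering_def)
  have "bij_betw (inv_into {1..n} A' \<circ> A) {1..n} {1..n}"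
    by (rule bij_betw_trans[OF bij(1) bij_betw_inv_into[OF bij(2)]])
  then have bij_\<pi>: "bij_betw \<pi> {1..n} {1..n}"
    by (rule bij_betw_cong[THEN iffD1, rotated]) (simp add: \<pi>_def)
  then have perm: "\<pi> permutes {1..n}"
    by (rule bij_imp_permutes) (auto simp: \<pi>_def)
  have A_\<pi>: "A i = A' (\<pi> i)" if "i \<in> {1..n}" for i
  proof -
    have "A i \<in> A' ` {1..n}" using bij that by (auto simp: bij_betw_def)
    then show ?thesis using that f_inv_into_f[of "A i" A' "{1..n}"] by (simp add: \<pi>_def)
  qed
  have \<pi>1: "\<pi> 1 = 1"
  proof -
    have "A 1 = A' 1" using A A' by (simp add: consistent_ordering_def)
    moreover have "\<pi> 1 \<in> {1..n}" using bij_betwE[OF bij_\<pi>] n by blast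
    ultimately show ?thesis
      using A_\<pi>[OF n] inj_onD[OF bij_betw_imp_inj_on[OF bij(2)], of "\<pi> 1" 1] n by metis
  qed
  define \<Delta> where "\<Delta> i = (if i = 0 then UNIV else \<Gamma> (A i))" for i
  have \<Delta>: "\<forall>i\<le>n. \<Delta> i \<in> sets borel"
    using \<Gamma> bij_betwE[OF bij(1)] by (auto simp: \<Delta>_def)
  have split: "{1..n} = insert 1 {2..n}" using n by auto
  have l: "(\<Prod>i\<in>{1..n}. indicator (\<Gamma> (A i)) (increment x i) :: ennreal) =
      indicator (\<Delta> 0) (x 0) * indicator (\<Delta> 1) (x 1) *
      (\<Prod>i\<in>{2..n}. indicator (\<Delta> i) (x i - x (i - 1)))" for x
    unfolding split by (auto simp: \<Delta>_def increment_def intro!: prod.cong arg_cong2[of _ _ _ _ "(*)"])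
  have r: "(\<Prod>i\<in>{1..n}. indicator (\<Gamma> (A' i)) (increment y i) :: ennreal) =
      indicator (\<Delta> 0) (y 0) * indicator (\<Delta> 1) (y 1) *
      (\<Prod>i\<in>{2..n}. indicator (\<Delta> i) (y (\<pi> i) - y (\<pi> i - 1)))" for y
  proof -
    have "(\<Prod>i\<in>{1..n}. indicator (\<Gamma> (A' i)) (increment y i) :: ennreal) =
        (\<Prod>i\<in>{1..n}. indicator (\<Gamma> (A' (\<pi> i))) (increment y (\<pi> i)))"
      by (rule prod.reindex_bij_betw[OF bij_\<pi>, symmetric])
    also have "\<dots> = (\<Prod>i\<in>{1..n}. indicator (\<Delta> i) (increment y (\<pi> i)))"
      by (rule prod.cong) (auto simp: \<Delta>_def A_\<pi>)
    also have "\<dots> = indicator (\<Delta> 1) (increment y 1) *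
        (\<Prod>i\<in>{2..n}. indicator (\<Delta> i) (increment y (\<pi> i)))"
      unfolding split using \<pi>1 by simp
    also have "(\<Prod>i\<in>{2..n}. indicator (\<Delta> i) (increment y (\<pi> i)) :: ennreal) =
        (\<Prod>i\<in>{2..n}. indicator (\<Delta> i) (y (\<pi> i) - y (\<pi> i - 1)))"
    proof (rule prod.cong)
      fix i assume i: "i \<in> {2..n}"
      then have "\<pi> i \<noteq> \<pi> 1"
        using inj_onD[OF bij_betw_imp_inj_on[OF bij_\<pi>], of i 1] n by auto
      then show "indicator (\<Delta> i) (increment y (\<pi> i)) =
          (indicator (\<Delta> i) (y (\<pi> i) - y (\<pi> i - 1)) :: ennreal)"
        unfolding \<pi>1 increment_def by simp
    qed simp
    finally show ?thesis by (simp add: increment_def \<Delta>_def)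
  qed
  show "emeasure ?L (Pi\<^sub>E S \<Gamma>) = emeasure ?R (Pi\<^sub>E S \<Gamma>)"
    unfolding rect[OF A] rect[OF A'] l r
    by (rule consistency[OF S A A' perm \<pi>1 _ \<Delta>]) (use A_\<pi> in auto)
qed

text \<open>The values are sums of increments that are selected by inclusion alone, so they inherit the
  independence of the ordering.\<close>

lemma joint_law_permute:
  assumes S: "finite_subsemilattice \<A> S" and A: "consistent_ordering \<A> S n A"
    and A': "consistent_ordering \<A> S n A'"
  shows "joint_law A n J = joint_law A' n J"
proof -
  have fin: "finite S" using S by (simp add: finite_subsemilattice_def)
  define G where "G z = (\<lambda>B\<in>J. \<Sum>D | D \<in> S \<and> D \<subseteq> B. z D)" for z :: "'t set \<Rightarrow> real"
  have G: "G \<in> PiM S (\<lambda>_. borel) \<rightarrow>\<^sub>M PiM J (\<lambda>_. borel)"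
    unfolding G_def
    by (intro measurable_restrict borel_measurable_sum measurable_component_singleton) auto
  have "joint_law B n J = distr (distr (path_law B n) (PiM S (\<lambda>_. borel))
      (\<lambda>x. \<lambda>D\<in>S. increment x (inv_into {1..n} B D))) (PiM J (\<lambda>_. borel)) G"
    if B: "consistent_ordering \<A> S n B" for B
  proof -
    have bij: "bij_betw B {1..n} S" using B by (simp add: consistent_ordering_def)
    have meas: "(\<lambda>x. \<lambda>D\<in>S. increment x (inv_into {1..n} B D)) \<in> path_law B n \<rightarrow>\<^sub>M PiM S (\<lambda>_. borel)"
      unfolding measurable_path_law[OF S B] by (rule measurable_restrict) measurable
    have "(\<Sum>D | D \<in> S \<and> D \<subseteq> C. (\<lambda>D\<in>S. increment x (inv_into {1..n} B D)) D) =
        set_value B n x C" for x C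
    proof -
      have "bij_betw B {i. i \<in> {1..n} \<and> B i \<subseteq> C} {D. D \<in> S \<and> D \<subseteq> C}"
        by (rule bij_betw_subset[OF bij]) (use bij_betw_imp_surj_on[OF bij] in blast)+
      from sum.reindex_bij_betw[OF this, symmetric]
      have "(\<Sum>D | D \<in> S \<and> D \<subseteq> C. (\<lambda>D\<in>S. increment x (inv_into {1..n} B D)) D) =
          (\<Sum>i | i \<in> {1..n} \<and> B i \<subseteq> C. (\<lambda>D\<in>S. increment x (inv_into {1..n} B D)) (B i))" .
      also have "\<dots> = set_value B n x C"
        unfolding set_value_def
        using bij_betwE[OF bij] bij_betw_inv_into_left[OF bij] by (intro sum.cong) auto
      finally show ?thesis .
    qed
    then show ?thesis
      unfolding distr_distr[OF G meas] joint_law_def G_def comp_def by (simp only:)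
  qed
  from this[OF A] this[OF A'] show ?thesis
    unfolding increments_permute[OF S A A'] by simp
qed

lemma joint_law_refine:
  assumes S: "finite_subsemilattice \<A> S" and A: "consistent_ordering \<A> S n A"
    and S': "finite_subsemilattice \<A> S'" and A': "consistent_ordering \<A> S' n' A'"
    and "S \<subseteq> S'" "J \<subseteq> S"
  shows "joint_law A n J = joint_law A' n' J"
proof -
  obtain A'' \<phi> where A'': "consistent_ordering \<A> S' (card S') A''"
    and \<phi>: "mono \<phi>" "\<phi> 0 = 0" "\<phi> n \<le> card S'"
    and U: "\<And>k. k \<le> n \<Longrightarrow> (\<Union>j\<le>\<phi> k. A'' j) = (\<Union>j\<le>k. A j)"
    and eq: "\<And>x B. B \<in> S \<Longrightarrow>
      set_value A'' (card S') x B = set_value A n (stop_path n (x \<circ> \<phi>)) B"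
    using refine_ordering[OF S S' assms(5) A] by metis
  interpret C: inhomogeneous_chain \<mu> "chain_kernel A''" "card S'" by (rule ordering_chain[OF S' A''])
  have \<phi>': "mono_on {..n} \<phi>" using \<phi>(1) by (auto intro: mono_onI monoD)
  have "path_law A n = chain_law \<mu> (\<lambda>i j. chain_kernel A'' (\<phi> i) (\<phi> j)) n"
    unfolding path_law_def by (rule chain_law_cong) (simp add: chain_kernel_def U)
  also have "\<dots> = distr (path_law A'' (card S')) path_space (\<lambda>x. stop_path n (x \<circ> \<phi>))"
    unfolding path_law_def by (rule C.distr_coarsen[OF \<phi>' \<phi>(2,3), symmetric])
  finally have law: "path_law A n = distr (path_law A'' (card S')) path_space (\<lambda>x. stop_path n (x \<circ> \<phi>))" .
  have coarse: "(\<lambda>x. stop_path n (x \<circ> \<phi>)) \<in> path_law A'' (card S') \<rightarrow>\<^sub>M path_space"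
    unfolding measurable_path_law[OF S' A''] by (rule C.measurable_coarsen)
  have "(\<lambda>B\<in>J. set_value A n (stop_path n (x \<circ> \<phi>)) B) = (\<lambda>B\<in>J. set_value A'' (card S') x B)" for x
    by (rule restrict_ext) (use eq \<open>J \<subseteq> S\<close> in auto)
  then have "joint_law A n J = joint_law A'' (card S') J"
    unfolding joint_law_def law distr_distr[OF measurable_set_values coarse]
    unfolding comp_def by (simp only:)
  also have "\<dots> = joint_law A' n' J"
    using joint_law_permute[OF S' A'' ] A' consistent_ordering_bij(3)[OF A'] by blast
  finally show ?thesis .
qed

text \<open>Two semilattices are compared through one that contains both.\<close>

lemma joint_law_unique:
  assumes S: "finite_subsemilattice \<A> S" and A: "consistent_ordering \<A> S n A" and "J \<subseteq> S"
    and S': "finite_subsemilattice \<A> S'" and A': "consistent_ordering \<A> S' n' A'" and "J \<subseteq> S'"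
  shows "joint_law A n J = joint_law A' n' J"
proof -
  have "finite (S \<union> S')" "S \<union> S' \<subseteq> \<A> - {{}}"
    using S S' by (auto simp: finite_subsemilattice_def)
  then obtain T where T: "finite_subsemilattice \<A> T" "S \<union> S' \<subseteq> T"
    using finite_subsemilattice_generated by metis
  obtain B where B: "consistent_ordering \<A> T (card T) B"
    using consistent_ordering_exists[OF T(1), of "\<lambda>_. 0"] by auto
  show ?thesis
    using joint_law_refine[OF S A T(1) B _ \<open>J \<subseteq> S\<close>] joint_law_refine[OF S' A' T(1) B _ \<open>J \<subseteq> S'\<close>] T(2)
    by auto
qed

text \<open>By \<open>joint_law_unique\<close> the choice is from a single law.\<close>

definition marginal_law :: "'t set set \<Rightarrow> ('t set \<Rightarrow> real) measure" where
  "marginal_law J = (SOME N. \<exists>S n A. finite_subsemilattice \<A> S \<and> J \<subseteq> S \<and>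
    consistent_ordering \<A> S n A \<and> N = joint_law A n J)"

lemma marginal_law_eq:
  assumes "finite_subsemilattice \<A> S" "consistent_ordering \<A> S n A" "J \<subseteq> S"
  shows "marginal_law J = joint_law A n J"
proof -
  have "\<exists>N S n A. finite_subsemilattice \<A> S \<and> J \<subseteq> S \<and>
    consistent_ordering \<A> S n A \<and> N = joint_law A n J" using assms by blast
  from someI_ex[OF this] obtain S' n' A' where "finite_subsemilattice \<A> S'" "J \<subseteq> S'"
    "consistent_ordering \<A> S' n' A'" "marginal_law J = joint_law A' n' J"
    unfolding marginal_law_def by blast
  then show ?thesis using joint_law_unique[of S' n' A' J S n A] assms by simp
qed

lemma ordering_for:
  assumes "finite J" "J \<subseteq> \<A> - {{}}"
  obtains S n A where "finite_subsemilattice \<A> S" "consistent_ordering \<A> S n A" "J \<subseteq> S" "min_set \<A> \<in> S"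
proof -
  obtain S where S: "finite_subsemilattice \<A> S" "J \<subseteq> S" "min_set \<A> \<in> S"
    using finite_subsemilattice_generated[OF assms] by metis
  obtain A where "consistent_ordering \<A> S (card S) A"
    using consistent_ordering_exists[OF S(1), of "\<lambda>_. 0"] by auto
  then show ?thesis using that S by blast
qed

lemma polish_projective_marginal_law: "polish_projective (\<A> - {{}}) marginal_law"
proof -
  have "projective_family (\<A> - {{}}) marginal_law (\<lambda>_. borel)"
  proof (rule projective_family.intro)
    fix J H assume JH: "J \<subseteq> H" "finite H" "H \<subseteq> \<A> - {{}}"
    obtain S n A where S: "finite_subsemilattice \<A> S" "consistent_ordering \<A> S n A" "H \<subseteq> S"
      using ordering_for[OF JH(2,3)] by metis
    have *: "marginal_law H = joint_law A n H" "marginal_law J = joint_law A n J"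
      using marginal_law_eq[OF S(1,2)] S(3) JH(1) by auto
    have m: "(\<lambda>x. \<lambda>B\<in>H. set_value A n x B) \<in> path_law A n \<rightarrow>\<^sub>M PiM H (\<lambda>_. borel)"
      unfolding measurable_path_law[OF S(1,2)] by (rule measurable_set_values)
    have r: "(\<lambda>f. restrict f J) \<in> PiM H (\<lambda>_. borel) \<rightarrow>\<^sub>M PiM J (\<lambda>_. borel)"
      by (rule measurable_restrict_subset[OF JH(1)])
    have "H \<inter> J = J" using JH(1) by auto
    then show "marginal_law J = distr (marginal_law H) (PiM J (\<lambda>_. borel)) (\<lambda>f. restrict f J)"
      unfolding * unfolding joint_law_def distr_distr[OF r m] comp_def restrict_restrict by simp
  next
    fix J assume J: "finite J" "J \<subseteq> \<A> - {{}}"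
    obtain S n A where S: "finite_subsemilattice \<A> S" "consistent_ordering \<A> S n A" "J \<subseteq> S"
      using ordering_for[OF J] by metis
    interpret P: prob_space "path_law A n" by (rule prob_space_path_law[OF S(1,2)])
    have "(\<lambda>x. \<lambda>B\<in>J. set_value A n x B) \<in> path_law A n \<rightarrow>\<^sub>M PiM J (\<lambda>_. borel)"
      unfolding measurable_path_law[OF S(1,2)] by (rule measurable_set_values)
    then show "prob_space (marginal_law J)"
      unfolding marginal_law_eq[OF S] joint_law_def by (rule P.prob_space_distr)
  qed
  then show ?thesis by (simp add: polish_projective_def)
qed

section \<open>The projective limit\<close>

definition limit_law :: "('t set \<Rightarrow> real) measure" where
  "limit_law = completion (projective_family.lim (\<A> - {{}}) marginal_law (\<lambda>_. borel))"

text \<open>The projective limit is indexed by the non-empty sets of \<open>\<A>\<close>. The value at the empty set has to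
  be \<open>0\<close> and is put in by hand.\<close>

definition process :: "'t set \<Rightarrow> ('t set \<Rightarrow> real) \<Rightarrow> real" where
  "process B \<omega> = (if B = {} then 0 else \<omega> B)"

sublocale projective: polish_projective "\<A> - {{}}" marginal_law
  by (rule polish_projective_marginal_law)

lemma measurable_process: 
  assumes "B \<in> \<A>" shows "process B \<in> borel_measurable limit_law"
proof -
  have "process B \<in> borel_measurable projective.lim"
    unfolding process_def
    using measurable_component_singleton[of B "\<A> - {{}}" "\<lambda>_. borel"] assms
    by (cases "B = {}") (auto simp: measurable_cong_sets[OF projective.sets_lim refl])
  then show ?thesis unfolding limit_law_def by (rule measurable_completion)
qed

lemma prob_space_limit_law: "prob_space limit_law"
proof -
  let ?X = "space (PiM {} (\<lambda>_. borel :: real measure)) :: ('t set \<Rightarrow> real) set"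
  interpret P: prob_space "marginal_law {}" by (rule projective.prob_space_P) auto
  have sp: "space (marginal_law {}) = ?X" by (rule projective.space_P) auto
  have "prod_emb (\<A> - {{}}) (\<lambda>_. borel) {} ?X = space projective.lim"
    by (auto simp: prod_emb_def space_PiM)
  then have "emeasure projective.lim (space projective.lim) = emeasure (marginal_law {}) ?X"
    using projective.emeasure_lim_emb[of "{}" ?X] by simp
  also have "\<dots> = 1" using P.emeasure_space_1 sp by simp
  finally have "prob_space projective.lim" by (rule prob_spaceI)
  then show ?thesis unfolding limit_law_def by (rule prob_space.prob_space_completion)
qed

lemma process_law:
  assumes S: "finite_subsemilattice \<A> S" and A: "consistent_ordering \<A> S n A" and "J \<subseteq> S"
  shows "distr limit_law (PiM J (\<lambda>_. borel)) (\<lambda>\<omega>. \<lambda>B\<in>J. process B \<omega>) = joint_law A n J"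
proof -
  have J: "finite J" "J \<subseteq> \<A> - {{}}"
    using S \<open>J \<subseteq> S\<close> by (auto simp: finite_subsemilattice_def intro: finite_subset)
  have proc: "(\<lambda>B\<in>J. process B \<omega>) = restrict \<omega> J" for \<omega>
    by (rule restrict_ext) (use J in \<open>auto simp: process_def\<close>)
  have r: "(\<lambda>\<omega>. restrict \<omega> J) \<in> projective.lim \<rightarrow>\<^sub>M PiM J (\<lambda>_. borel)"
    unfolding measurable_cong_sets[OF projective.sets_lim refl]
    by (rule measurable_restrict_subset[OF J(2)])
  have "distr projective.lim (PiM J (\<lambda>_. borel)) (\<lambda>\<omega>. restrict \<omega> J) = marginal_law J"
  proof (rule measure_eqI)
    show "sets (distr projective.lim (PiM J (\<lambda>_. borel)) (\<lambda>\<omega>. restrict \<omega> J)) = sets (marginal_law J)"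
      using projective.sets_P[OF J] by simp
    fix X assume "X \<in> sets (distr projective.lim (PiM J (\<lambda>_. borel)) (\<lambda>\<omega>. restrict \<omega> J))"
    then have X: "X \<in> sets (PiM J (\<lambda>_. borel))" by simp
    have "(\<lambda>\<omega>. restrict \<omega> J) -` X \<inter> space projective.lim =
        prod_emb (\<A> - {{}}) (\<lambda>_. borel) J X"
      by (auto simp: prod_emb_def space_PiM)
    then show "emeasure (distr projective.lim (PiM J (\<lambda>_. borel)) (\<lambda>\<omega>. restrict \<omega> J)) X =
        emeasure (marginal_law J) X"
      unfolding emeasure_distr[OF r X] using projective.emeasure_lim_emb[OF J(2,1) X] by simp
  qed
  then show ?thesis
    unfolding proc limit_law_def distr_completion[OF r] using marginal_law_eq[OF assms] by simp
qed

end

section \<open>Additive extensions and linear relations between indicators\<close>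

text \<open>The same coefficients are applied to the values of \<open>X\<close> and to indicator functions. Carrying both
  sides along reduces identities between values to identities between functions on the space.\<close>

definition combination ::
    "('t set \<Rightarrow> 'w \<Rightarrow> real) \<Rightarrow> 't set set \<Rightarrow> ('w \<Rightarrow> real) \<Rightarrow> ('t \<Rightarrow> real) \<Rightarrow> bool" where
  "combination X \<C> Y f \<longleftrightarrow> (\<exists>F c. finite F \<and> F \<subseteq> \<C> \<and>
    (\<forall>\<omega>. Y \<omega> = (\<Sum>D\<in>F. c D * X D \<omega>)) \<and> (\<forall>t. f t = (\<Sum>D\<in>F. c D * indicator D t)))"

lemma combination_base:
  assumes "A \<in> \<C>"
  shows "combination X \<C> (X A) (indicator A)"
  unfolding combination_def
  by (rule exI[of _ "{A}"], rule exI[of _ "\<lambda>_. 1"]) (use assms in auto)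

lemma combination_mono: "combination X \<C> Y f \<Longrightarrow> \<C> \<subseteq> \<D> \<Longrightarrow> combination X \<D> Y f"
  unfolding combination_def by blast

lemma combination_zero: "combination X \<C> (\<lambda>_. 0) (\<lambda>_. 0)"
  unfolding combination_def by (rule exI[of _ "{}"]) auto

lemma combination_add_scaled:
  assumes "combination X \<C> Y f" "combination X \<C> Z g"
  shows "combination X \<C> (\<lambda>\<omega>. Y \<omega> + a * Z \<omega>) (\<lambda>t. f t + a * g t)"
proof -
  obtain F c where F: "finite F" "F \<subseteq> \<C>" "\<And>\<omega>. Y \<omega> = (\<Sum>D\<in>F. c D * X D \<omega>)"
    "\<And>t. f t = (\<Sum>D\<in>F. c D * indicator D t)"
    using assms(1) unfolding combination_def by blast
  obtain G d where G: "finite G" "G \<subseteq> \<C>" "\<And>\<omega>. Z \<omega> = (\<Sum>D\<in>G. d D * X D \<omega>)"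
    "\<And>t. g t = (\<Sum>D\<in>G. d D * indicator D t)"
    using assms(2) unfolding combination_def by blast
  define e where "e D = (if D \<in> F then c D else 0) + a * (if D \<in> G then d D else 0)" for D
  have e: "(\<Sum>D\<in>F. c D * h D) + a * (\<Sum>D\<in>G. d D * h D) = (\<Sum>D\<in>F \<union> G. e D * h D)"
    for h :: "'a set \<Rightarrow> real"
  proof -
    have "(\<Sum>D\<in>F. c D * h D) = (\<Sum>D\<in>F \<union> G. (if D \<in> F then c D else 0) * h D)"
      by (rule sum.mono_neutral_cong_left) (use F(1) G(1) in auto)
    moreover have "a * (\<Sum>D\<in>G. d D * h D) = (\<Sum>D\<in>F \<union> G. a * (if D \<in> G then d D else 0) * h D)"
      unfolding sum_distrib_left
      by (rule sum.mono_neutral_cong_left) (use F(1) G(1) in auto)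
    ultimately show ?thesis
      by (simp only: e_def distrib_right sum.distrib)
  qed
  show ?thesis
    unfolding combination_def F(3,4) G(3,4)
    by (rule exI[of _ "F \<union> G"], rule exI[of _ e], intro conjI allI e) (use F(1,2) G(1,2) in auto)
qed

lemma combination_diff:
  assumes "combination X \<C> Y f" "combination X \<C> Z g"
  shows "combination X \<C> (\<lambda>\<omega>. Y \<omega> - Z \<omega>) (\<lambda>t. f t - g t)"
  using combination_add_scaled[OF assms, of "-1"] by simp

lemma combination_sum:
  assumes "finite I" "\<And>i. i \<in> I \<Longrightarrow> combination X \<C> (Y i) (f i)"
  shows "combination X \<C> (\<lambda>\<omega>. \<Sum>i\<in>I. a i * Y i \<omega>) (\<lambda>t. \<Sum>i\<in>I. a i * f i t)"
  using assms
proof (induction I rule: finite_induct)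
  case empty
  then show ?case using combination_zero by simp
next
  case (insert i I)
  have "combination X \<C> (\<lambda>\<omega>. (\<Sum>i\<in>I. a i * Y i \<omega>) + a i * Y i \<omega>)
      (\<lambda>t. (\<Sum>i\<in>I. a i * f i t) + a i * f i t)"
    by (rule combination_add_scaled) (use insert in auto)
  then show ?case using insert(1,2) by (simp add: add.commute)
qed

lemma combination_measurable:
  assumes "combination X \<C> Y f" "\<And>D. D \<in> \<C> \<Longrightarrow> X D \<in> borel_measurable N"
  shows "Y \<in> borel_measurable N"
proof -
  obtain F c where F: "F \<subseteq> \<C>" "\<And>\<omega>. Y \<omega> = (\<Sum>D\<in>F. c D * X D \<omega>)"
    using assms(1) unfolding combination_def by blast
  have "Y = (\<lambda>\<omega>. \<Sum>D\<in>F. c D * X D \<omega>)" using F(2) by auto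
  then show ?thesis
    by (simp only:) (intro borel_measurable_sum borel_measurable_times assms(2) borel_measurable_const,
        use F(1) in auto)
qed

lemma indicator_UN_inclusion_exclusion:
  fixes C :: "nat \<Rightarrow> 't set"
  shows "(indicator (\<Union>i\<in>{1..n}. C i) t :: real) =
    (\<Sum>I | I \<subseteq> {1..n} \<and> I \<noteq> {}. (-1) ^ (card I + 1) * indicator (\<Inter>i\<in>I. C i) t)"
proof -
  let ?N = "{1..n::nat}"
  have prod_ind: "(\<Prod>i\<in>I. indicator (C i) t :: real) = indicator (\<Inter>i\<in>I. C i) t" if "finite I" for I
    using that by (induction I rule: finite_induct) (auto simp: indicator_def)
  have "indicator (\<Union>i\<in>?N. C i) t = 1 - (\<Prod>i\<in>?N. - indicator (C i) t + 1 :: real)"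
  proof (cases "t \<in> (\<Union>i\<in>?N. C i)")
    case True
    then obtain i where "i \<in> ?N" "t \<in> C i" by auto
    then have "(\<Prod>i\<in>?N. - indicator (C i) t + 1 :: real) = 0"
      by (intro prod_zero bexI[of _ i]) auto
    then show ?thesis using True by simp
  next
    case False
    then have "(\<Prod>i\<in>?N. - indicator (C i) t + 1 :: real) = 1"
      by (intro prod.neutral) auto
    then show ?thesis using False by simp
  qed
  also have "(\<Prod>i\<in>?N. - indicator (C i) t + 1 :: real) =
      (\<Sum>I\<in>Pow ?N. (-1) ^ card I * indicator (\<Inter>i\<in>I. C i) t)"
  proof -
    have "(\<Prod>i\<in>I. - indicator (C i) t :: real) = (-1) ^ card I * indicator (\<Inter>i\<in>I. C i) t"
      if "I \<in> Pow ?N" for I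
      using prod_ind[of I] that by (simp add: prod_uminus finite_subset)
    then show ?thesis
      unfolding prod_add[OF finite_atLeastAtMost] by (intro sum.cong refl) (simp only: prod.neutral_const mult_1_right)
  qed
  also have "Pow ?N = insert {} {I. I \<subseteq> ?N \<and> I \<noteq> {}}" by auto
  also have "(\<Sum>I\<in>insert {} {I. I \<subseteq> ?N \<and> I \<noteq> {}}. (-1) ^ card I * indicator (\<Inter>i\<in>I. C i) t :: real) =
      1 + (\<Sum>I | I \<subseteq> ?N \<and> I \<noteq> {}. (-1) ^ card I * indicator (\<Inter>i\<in>I. C i) t)"
    by (subst sum.insert) auto
  finally show ?thesis by (simp add: sum_negf)
qed

text \<open>The coefficients of the inclusion-exclusion sum are those of the inclusion-exclusion formula for
  indicator functions, so the sum represents the union.\<close>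

lemma combination_incl_excl:
  assumes "\<And>I. I \<subseteq> {1..n} \<Longrightarrow> I \<noteq> {} \<Longrightarrow>
    combination X \<C> (Y (\<Inter>i\<in>I. C i)) (indicator (\<Inter>i\<in>I. C i))"
  shows "combination X \<C> (incl_excl Y n C) (indicator (\<Union>i\<in>{1..n}. C i))"
proof -
  have "combination X \<C>
      (\<lambda>\<omega>. \<Sum>I | I \<subseteq> {1..n} \<and> I \<noteq> {}. (-1) ^ (card I + 1) * Y (\<Inter>i\<in>I. C i) \<omega>)
      (\<lambda>t. \<Sum>I | I \<subseteq> {1..n} \<and> I \<noteq> {}. (-1) ^ (card I + 1) * indicator (\<Inter>i\<in>I. C i) t)"
    by (rule combination_sum) (use assms in auto)
  moreover have "(\<lambda>\<omega>. \<Sum>I | I \<subseteq> {1..n} \<and> I \<noteq> {}. (-1) ^ (card I + 1) * Y (\<Inter>i\<in>I. C i) \<omega>) =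
      incl_excl Y n C"
    by (rule ext) (simp only: incl_excl_def)
  moreover have "(\<lambda>t. \<Sum>I | I \<subseteq> {1..n} \<and> I \<noteq> {}. (-1) ^ (card I + 1) * indicator (\<Inter>i\<in>I. C i) t) =
      (indicator (\<Union>i\<in>{1..n}. C i) :: _ \<Rightarrow> real)"
    by (rule ext) (rule indicator_UN_inclusion_exclusion[symmetric])
  ultimately show ?thesis by (simp only:)
qed

lemma ext_unions_eq:
  assumes "B \<in> fin_unions \<A>" "{} \<in> \<A>"
  obtains n C where "\<And>i. i \<in> {1..n} \<Longrightarrow> C i \<in> \<A>" "B = (\<Union>i\<in>{1..n}. C i)"
    "ext_unions \<A> X B = incl_excl X n C"
proof -
  obtain F where F: "finite F" "F \<subseteq> \<A>" "B = \<Union>F" using assms(1) by (auto simp: fin_unions_def)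
  have "\<exists>n\<ge>1::nat. \<exists>C. (\<forall>i\<in>{1..n}. C i \<in> \<A>) \<and> B = (\<Union>i\<in>{1..n}. C i)"
  proof (cases "F = {}")
    case True
    then show ?thesis using F assms(2) by (intro exI[of _ "1::nat"] conjI exI[of _ "\<lambda>_. {}"]) auto
  next
    case False
    obtain C where C: "bij_betw C {1..card F} F" using ex_bij_betw_nat_finite_1[OF F(1)] by auto
    have "1 \<le> card F" using False F(1) by (simp add: Suc_le_eq card_gt_0_iff)
    moreover have "B = (\<Union>i\<in>{1..card F}. C i)" using C F by (auto simp: bij_betw_def)
    moreover have "\<forall>i\<in>{1..card F}. C i \<in> \<A>" using bij_betwE[OF C] F by auto
    ultimately show ?thesis by blast
  qed
  then have "\<exists>Z n C. n \<ge> 1 \<and> (\<forall>i\<in>{1..n}. C i \<in> \<A>) \<and> B = (\<Union>i\<in>{1..n}. C i) \<and>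
       Z = incl_excl X n C" by blast
  from someI_ex[OF this] show ?thesis using that unfolding ext_unions_def by blast
qed

context
  fixes \<A> :: "'t set set" and X :: "'t set \<Rightarrow> 'w \<Rightarrow> real"
  assumes Inter_closed: "\<And>F. F \<subseteq> \<A> \<Longrightarrow> \<Inter>F \<in> \<A>" and empty_closed: "{} \<in> \<A>"
begin

text \<open>Whatever representation of \<open>B\<close> the choice picks, its members and their intersections lie
  inside \<open>B\<close>; this is what makes the value at \<open>B\<close> measurable for the filtration at \<open>B\<close>.\<close>

lemma combination_ext_unions:
  assumes "B \<in> fin_unions \<A>"
  shows "combination X {D\<in>\<A>. D \<subseteq> B} (ext_unions \<A> X B) (indicator B)"
proof -
  obtain n C where C: "\<And>i. i \<in> {1..n} \<Longrightarrow> C i \<in> \<A>" "B = (\<Union>i\<in>{1..n}. C i)"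
    "ext_unions \<A> X B = incl_excl X n C"
    using ext_unions_eq[OF assms empty_closed] by metis
  show ?thesis
    unfolding C(3) unfolding C(2)
  proof (rule combination_incl_excl, rule combination_base)
    fix I assume I: "I \<subseteq> {1..n}" "I \<noteq> {}"
    then have "(\<Inter>i\<in>I. C i) \<in> \<A>" using C(1) by (intro Inter_closed) auto
    then show "(\<Inter>i\<in>I. C i) \<in> {D \<in> \<A>. D \<subseteq> (\<Union>i\<in>{1..n}. C i)}" using I by blast
  qed
qed

lemma combination_ext_unions': "B \<in> fin_unions \<A> \<Longrightarrow> combination X \<A> (ext_unions \<A> X B) (indicator B)"
  by (rule combination_mono[OF combination_ext_unions]) auto

lemma Int_fin_unions: "A \<in> \<A> \<Longrightarrow> B \<in> fin_unions \<A> \<Longrightarrow> A \<inter> B \<in> fin_unions \<A>"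
proof -
  assume A: "A \<in> \<A>" and "B \<in> fin_unions \<A>"
  then obtain F where F: "finite F" "F \<subseteq> \<A>" "B = \<Union>F" by (auto simp: fin_unions_def)
  have "A \<inter> D \<in> \<A>" if "D \<in> F" for D using Inter_closed[of "{A, D}"] A F that by auto
  then show ?thesis
    unfolding fin_unions_def using F by (intro CollectI exI[of _ "(\<inter>) A ` F"]) auto
qed

lemma combination_difference:
  assumes "A \<in> \<A>" "B \<in> fin_unions \<A>"
  shows "combination X \<A> (\<lambda>\<omega>. X A \<omega> - ext_unions \<A> X (A \<inter> B) \<omega>) (indicator (A - B))"
proof -
  have "combination X \<A> (\<lambda>\<omega>. X A \<omega> - ext_unions \<A> X (A \<inter> B) \<omega>)
      (\<lambda>t. indicator A t - indicator (A \<inter> B) t)"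
    by (intro combination_diff combination_base combination_ext_unions' Int_fin_unions assms)
  moreover have "(\<lambda>t. indicator A t - indicator (A \<inter> B) t) = (indicator (A - B) :: 't \<Rightarrow> real)"
    by (rule ext) (auto simp: indicator_def)
  ultimately show ?thesis by (simp only:)
qed

lemma combination_ext_diff:
  assumes "C \<in> diff_sets \<A>"
  shows "combination X \<A> (ext_diff \<A> X C) (indicator C)"
proof -
  have "\<exists>Z A B. A \<in> \<A> \<and> B \<in> fin_unions \<A> \<and> C = A - B \<and>
       Z = (\<lambda>\<omega>. X A \<omega> - ext_unions \<A> X (A \<inter> B) \<omega>)"
    using assms by (auto simp: diff_sets_def)
  from someI_ex[OF this] obtain A B where "A \<in> \<A>" "B \<in> fin_unions \<A>" "C = A - B"
    "ext_diff \<A> X C = (\<lambda>\<omega>. X A \<omega> - ext_unions \<A> X (A \<inter> B) \<omega>)"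
    unfolding ext_diff_def by blast
  then show ?thesis using combination_difference by simp
qed

lemma Inter_diff_sets:
  assumes "finite I" "I \<noteq> {}" "\<And>i. i \<in> I \<Longrightarrow> C i \<in> diff_sets \<A>"
  shows "(\<Inter>i\<in>I. C i) \<in> diff_sets \<A>"
  using assms
proof (induction I rule: finite_ne_induct)
  case (insert i I)
  then have "(\<Inter>i\<in>I. C i) \<in> diff_sets \<A>" "C i \<in> diff_sets \<A>" by auto
  then obtain A B A' B' where *: "A \<in> \<A>" "B \<in> fin_unions \<A>" "C i = A - B"
    "A' \<in> \<A>" "B' \<in> fin_unions \<A>" "(\<Inter>i\<in>I. C i) = A' - B'"
    unfolding diff_sets_def by blast
  obtain F G where "finite F" "F \<subseteq> \<A>" "B = \<Union>F" "finite G" "G \<subseteq> \<A>" "B' = \<Union>G"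
    using *(2,5) unfolding fin_unions_def by blast
  then have "B \<union> B' \<in> fin_unions \<A>"
    unfolding fin_unions_def by (intro CollectI exI[of _ "F \<union> G"]) auto
  moreover have "A \<inter> A' \<in> \<A>" using Inter_closed[of "{A, A'}"] * by auto
  moreover have "(\<Inter>i\<in>insert i I. C i) = A \<inter> A' - (B \<union> B')"
    using *(3,6) by auto
  ultimately show ?case unfolding diff_sets_def by blast
qed auto

text \<open>Every side of the equations that define an additive extension is a combination of values of \<open>X\<close>
  that represents the indicator function of the set in question. Two combinations for the same set
  differ by a linear relation between indicators.\<close>

lemma additive_ext_diff_unionsI:
  assumes rel: "\<And>F c. finite F \<Longrightarrow> F \<subseteq> \<A> \<Longrightarrow> (\<And>t. (\<Sum>D\<in>F. c D * indicator D t) = 0) \<Longrightarrow>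
    AE \<omega> in M. (\<Sum>D\<in>F. c D * X D \<omega>) = 0"
  shows "additive_ext_diff_unions M \<A> X"
proof -
  have eq: "AE \<omega> in M. Y \<omega> = Z \<omega>" if Y: "combination X \<A> Y f" and Z: "combination X \<A> Z f" for Y Z f
  proof -
    obtain F c where F: "finite F" "F \<subseteq> \<A>" "\<And>\<omega>. Y \<omega> - Z \<omega> = (\<Sum>D\<in>F. c D * X D \<omega>)"
      "\<And>t. f t - f t = (\<Sum>D\<in>F. c D * indicator D t)"
      using combination_diff[OF Y Z] unfolding combination_def by blast
    have "AE \<omega> in M. (\<Sum>D\<in>F. c D * X D \<omega>) = 0"
      by (rule rel[OF F(1,2)]) (simp add: F(4)[symmetric])
    then show ?thesis by (simp add: F(3)[symmetric])
  qed
  have unions: "unions_consistent M \<C> Y"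
    if "\<And>I C. finite I \<Longrightarrow> I \<noteq> {} \<Longrightarrow> (\<And>i::nat. i \<in> I \<Longrightarrow> C i \<in> \<C>) \<Longrightarrow>
      combination X \<A> (Y (\<Inter>i\<in>I. C i)) (indicator (\<Inter>i\<in>I. C i))" for \<C> Y
    unfolding unions_consistent_def
  proof (intro allI impI)
    fix n m :: nat and C C'
    assume C: "\<forall>i\<in>{1..n}. C i \<in> \<C>" and C': "\<forall>j\<in>{1..m}. C' j \<in> \<C>"
      and same: "(\<Union>i\<in>{1..n}. C i) = (\<Union>j\<in>{1..m}. C' j)"
    have "combination X \<A> (incl_excl Y n C) (indicator (\<Union>i\<in>{1..n}. C i))"
      by (rule combination_incl_excl, rule that) (use C in \<open>auto intro: finite_subset\<close>)
    moreover have "combination X \<A> (incl_excl Y m C') (indicator (\<Union>i\<in>{1..m}. C' i))"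
      by (rule combination_incl_excl, rule that) (use C' in \<open>auto intro: finite_subset\<close>)
    ultimately show "AE \<omega> in M. incl_excl Y n C \<omega> = incl_excl Y m C' \<omega>"
      unfolding same by (rule eq)
  qed
  show ?thesis
    unfolding additive_ext_diff_unions_def additive_ext_diff_def
  proof (intro conjI ballI impI)
    show "unions_consistent M \<A> X"
      by (rule unions, rule combination_base, rule Inter_closed) auto
    show "unions_consistent M (diff_sets \<A>) (ext_diff \<A> X)"
      by (rule unions, rule combination_ext_diff, rule Inter_diff_sets) auto
    have "(indicator {} :: 't \<Rightarrow> real) = (\<lambda>_. 0)" by (rule ext) simp
    then have "combination X \<A> (X {}) (\<lambda>_. 0)"
      using combination_base[OF empty_closed, of X] by (simp only:)
    then show "AE \<omega> in M. X {} \<omega> = 0" by (rule eq[OF _ combination_zero])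
    fix A A' B B' assume "A \<in> \<A>" "A' \<in> \<A>" "B \<in> fin_unions \<A>" "B' \<in> fin_unions \<A>"
      and same: "A - B = A' - B'"
    then have "combination X \<A> (\<lambda>\<omega>. X A \<omega> - ext_unions \<A> X (A \<inter> B) \<omega>) (indicator (A - B))"
      "combination X \<A> (\<lambda>\<omega>. X A' \<omega> - ext_unions \<A> X (A' \<inter> B') \<omega>) (indicator (A' - B'))"
      by (blast intro: combination_difference)+
    then show "AE \<omega> in M. X A \<omega> - ext_unions \<A> X (A \<inter> B) \<omega> =
        X A' \<omega> - ext_unions \<A> X (A' \<inter> B') \<omega>"
      unfolding same by (rule eq)
  qed
qed

end

context consistent_transition_system begin

text \<open>The left neighbourhood of \<open>A i\<close> in the ordering.\<close>

definition fresh :: "(nat \<Rightarrow> 't set) \<Rightarrow> nat \<Rightarrow> 't set" where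
  "fresh A i = A i - (\<Union>j\<in>{1..<i}. A j)"

definition fresh_point :: "(nat \<Rightarrow> 't set) \<Rightarrow> nat \<Rightarrow> 't" where
  "fresh_point A i = (SOME t. t \<in> fresh A i)"

lemma fresh_point_in: "fresh A i \<noteq> {} \<Longrightarrow> fresh_point A i \<in> fresh A i"
  unfolding fresh_point_def by (rule someI_ex) auto

text \<open>The intersection of \<open>A i\<close> with \<open>D\<close> is a member \<open>A l\<close> with \<open>l \<le> i\<close>; a point of the left
  neighbourhood of \<open>A i\<close> lies in no earlier set, so \<open>l = i\<close>.\<close>

lemma fresh_point_iff:
  assumes S: "finite_subsemilattice \<A> S" and A: "consistent_ordering \<A> S n A"
    and i: "i \<in> {1..n}" and "D \<in> S" and t: "t \<in> fresh A i"
  shows "t \<in> D \<longleftrightarrow> A i \<subseteq> D"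
proof
  assume "t \<in> D"
  have "A i \<in> S" using consistent_ordering_bij(1)[OF A] i by auto
  then have "A i \<inter> D \<in> S" using S \<open>D \<in> S\<close> unfolding finite_subsemilattice_def by blast
  then obtain l where l: "l \<in> {1..n}" "A i \<inter> D = A l"
    using consistent_ordering_bij(1)[OF A] by blast
  then have "l \<le> i" using consistent_ordering_le[OF A l(1) i] by auto
  moreover have "\<not> l < i"
    using t \<open>t \<in> D\<close> l unfolding fresh_def by auto
  ultimately show "A i \<subseteq> D" using l by auto
qed (use t in \<open>auto simp: fresh_def\<close>)

text \<open>If \<open>A i\<close> is covered by the earlier sets, the union does not grow at step \<open>i\<close>, and the chain
  stays where it is because the kernel from a set to itself is the point mass. The case \<open>i = 1\<close> does
  not occur, since \<open>A 1\<close> is non-empty.\<close>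

lemma increment_redundant:
  assumes S: "finite_subsemilattice \<A> S" and A: "consistent_ordering \<A> S n A"
    and i: "i \<in> {1..n}" and empty: "fresh A i = {}"
  shows "AE x in path_law A n. increment x i = 0"
proof (cases "i = 1")
  case True
  then show ?thesis using empty ordering_sets(2)[OF S A, of 1] i by (simp add: fresh_def)
next
  case False
  then obtain m where m: "i = Suc m" "1 \<le> m" "m < n" using i by (cases i) auto
  interpret inhomogeneous_chain \<mu> "chain_kernel A" n by (rule ordering_chain[OF S A])
  have "A (Suc m) \<subseteq> (\<Union>l\<le>m. A l)"
    using empty m unfolding fresh_def by fastforce
  then have "(\<Union>l\<le>Suc m. A l) = (\<Union>l\<le>m. A l)" by (auto simp: atMost_Suc)
  then have "chain_kernel A m (Suc m) = chain_kernel A m m" by (simp add: chain_kernel_def)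
  then have stay: "chain_kernel A m (Suc m) x = return borel x" for x using kernel_refl[of m x] m by simp
  \<comment> \<open>The integral of \<open>f\<close> is the probability that the chain moves at step \<open>Suc m\<close>.\<close>
  define f where "f x y = (if y - x m = 0 then 0 else 1 :: ennreal)" for x :: "nat \<Rightarrow> real" and y :: real
  have f: "case_prod f \<in> borel_measurable (path_space \<Otimes>\<^sub>M borel)"
    unfolding f_def case_prod_unfold by measurable
  have meas: "(\<lambda>x. f (stop_path m x) (x (Suc m))) \<in> borel_measurable path_space"
    unfolding f_def stop_path_def by measurable
  have fm: "(\<lambda>y. f x y) \<in> borel_measurable borel" for x unfolding f_def by measurable
  have "(\<integral>\<^sup>+x. f (stop_path m x) (x (Suc m)) \<partial>path_law A n) =
      (\<integral>\<^sup>+x. (\<integral>\<^sup>+y. f (stop_path m x) y \<partial>chain_kernel A m (Suc m) (x m)) \<partial>path_law A n)"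
    unfolding path_law_def by (rule nn_integral_jump_within[OF _ _ f]) (use m in auto)
  also have "\<dots> = (\<integral>\<^sup>+x. 0 \<partial>path_law A n)"
    by (rule nn_integral_cong) (simp add: stay nn_integral_return fm, simp add: f_def stop_path_def)
  finally have "(\<integral>\<^sup>+x. f (stop_path m x) (x (Suc m)) \<partial>path_law A n) = 0" by simp
  then have "AE x in path_law A n. f (stop_path m x) (x (Suc m)) = 0"
    using meas by (subst (asm) nn_integral_0_iff_AE) (auto simp: measurable_path_law[OF S A])
  then show ?thesis
    by eventually_elim (use m in \<open>auto simp: f_def increment_def stop_path_def split: if_splits\<close>)
qed

text \<open>The chain defines the signed measure that puts mass \<open>increment x i\<close> on a point of the left
  neighbourhood of \<open>A i\<close>. A point of that left neighbourhood lies in a union of members of \<open>S\<close>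
  exactly if \<open>A i\<close> does, so this measure gives the values at all those unions.\<close>

lemma set_value_point_masses:
  assumes S: "finite_subsemilattice \<A> S" and A: "consistent_ordering \<A> S n A"
  shows "AE x in path_law A n. \<forall>G\<subseteq>S. set_value A n x (\<Union>G) =
    (\<Sum>i | i \<in> {1..n} \<and> fresh A i \<noteq> {}. increment x i * indicator (\<Union>G) (fresh_point A i))"
proof -
  have "AE x in path_law A n. \<forall>i\<in>{1..n}. fresh A i = {} \<longrightarrow> increment x i = 0"
    using increment_redundant[OF S A] by (intro AE_finite_allI) auto
  then show ?thesis
  proof eventually_elim
    case (elim x)
    show ?case
    proof (intro allI impI)
      fix G assume G: "G \<subseteq> S"
      have iff: "fresh_point A i \<in> \<Union>G \<longleftrightarrow> A i \<subseteq> \<Union>G" if "i \<in> {1..n}" "fresh A i \<noteq> {}" for i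
      proof
        assume "fresh_point A i \<in> \<Union>G"
        then obtain D where "D \<in> G" "fresh_point A i \<in> D" by auto
        then show "A i \<subseteq> \<Union>G"
          using fresh_point_iff[OF S A that(1) _ fresh_point_in[OF that(2)], of D] G by auto
      next
        assume "A i \<subseteq> \<Union>G"
        then show "fresh_point A i \<in> \<Union>G" using fresh_point_in[OF that(2)] by (auto simp: fresh_def)
      qed
      have "(\<Sum>i | i \<in> {1..n} \<and> fresh A i \<noteq> {}. increment x i * indicator (\<Union>G) (fresh_point A i)) =
          (\<Sum>i | i \<in> {1..n} \<and> fresh A i \<noteq> {}. if A i \<subseteq> \<Union>G then increment x i else 0)"
        using iff by (intro sum.cong refl) (simp add: indicator_def)
      also have "\<dots> = (\<Sum>i\<in>{1..n}. if A i \<subseteq> \<Union>G then increment x i else 0)"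
        by (rule sum.mono_neutral_left) (use elim in auto)
      also have "\<dots> = set_value A n x (\<Union>G)"
        unfolding set_value_def by (simp only: sum.inter_filter[symmetric] finite_atLeastAtMost)
      finally show "set_value A n x (\<Union>G) = (\<Sum>i | i \<in> {1..n} \<and> fresh A i \<noteq> {}.
        increment x i * indicator (\<Union>G) (fresh_point A i))" by (rule sym)
    qed
  qed
qed

lemma combination_path:
  assumes S: "finite_subsemilattice \<A> S" and A: "consistent_ordering \<A> S n A"
    and F: "F \<subseteq> S"
  shows "AE x in path_law A n. (\<Sum>D\<in>F. c D * set_value A n x D) =
    (\<Sum>i | i \<in> {1..n} \<and> fresh A i \<noteq> {}.
      increment x i * (\<Sum>D\<in>F. c D * indicator D (fresh_point A i)))"
  using set_value_point_masses[OF S A]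
proof eventually_elim
  case (elim x)
  have "set_value A n x D = (\<Sum>i | i \<in> {1..n} \<and> fresh A i \<noteq> {}.
      increment x i * indicator D (fresh_point A i))" if "D \<in> F" for D
    using elim[rule_format, of "{D}"] that F by auto
  then have "(\<Sum>D\<in>F. c D * set_value A n x D) = (\<Sum>D\<in>F. \<Sum>i | i \<in> {1..n} \<and> fresh A i \<noteq> {}.
      c D * (increment x i * indicator D (fresh_point A i)))"
    unfolding sum_distrib_left[symmetric] by (intro sum.cong refl arg_cong2[of _ _ _ _ "(*)"])
  also have "\<dots> = (\<Sum>i | i \<in> {1..n} \<and> fresh A i \<noteq> {}. \<Sum>D\<in>F.
      c D * (increment x i * indicator D (fresh_point A i)))"
    by (rule sum.swap)
  finally show ?case by (simp only: sum_distrib_left mult_ac)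
qed

text \<open>Almost sure statements about finitely many values of the process are statements about the chain.
  Measurability of \<open>R\<close> is essential here: exceptional sets are moved through equalities of laws.\<close>

lemma AE_process_iff:
  assumes S: "finite_subsemilattice \<A> S" and A: "consistent_ordering \<A> S n A"
    and R: "{z \<in> space (PiM S (\<lambda>_. borel)). R z} \<in> sets (PiM S (\<lambda>_. borel))"
  shows "(AE \<omega> in limit_law. R (\<lambda>B\<in>S. process B \<omega>)) \<longleftrightarrow>
    (AE x in path_law A n. R (\<lambda>B\<in>S. set_value A n x B))"
proof -
  have "S \<subseteq> \<A>" using S by (simp add: finite_subsemilattice_def)
  then have "(\<lambda>\<omega>. \<lambda>B\<in>S. process B \<omega>) \<in> limit_law \<rightarrow>\<^sub>M PiM S (\<lambda>_. borel)"
    by (intro measurable_restrict measurable_process) auto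
  then have "(AE \<omega> in limit_law. R (\<lambda>B\<in>S. process B \<omega>)) \<longleftrightarrow>
      (AE z in distr limit_law (PiM S (\<lambda>_. borel)) (\<lambda>\<omega>. \<lambda>B\<in>S. process B \<omega>). R z)"
    by (rule AE_distr_iff[OF _ R, symmetric])
  also have "\<dots> \<longleftrightarrow> (AE z in joint_law A n S. R z)"
    unfolding process_law[OF S A order_refl] ..
  also have "\<dots> \<longleftrightarrow> (AE x in path_law A n. R (\<lambda>B\<in>S. set_value A n x B))"
    unfolding joint_law_def
  proof (rule AE_distr_iff[OF _ R])
    show "(\<lambda>x. \<lambda>B\<in>S. set_value A n x B) \<in> path_law A n \<rightarrow>\<^sub>M PiM S (\<lambda>_. borel)"
      unfolding measurable_path_law[OF S A] by (rule measurable_set_values)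
  qed
  finally show ?thesis .
qed

lemma linear_relation:
  assumes "finite F" "F \<subseteq> \<A>" and zero: "\<And>t. (\<Sum>D\<in>F. c D * indicator D t) = (0 :: real)"
  shows "AE \<omega> in limit_law. (\<Sum>D\<in>F. c D * process D \<omega>) = 0"
proof -
  \<comment> \<open>The empty set is not an index of the limit, and contributes \<open>0\<close> on both sides.\<close>
  define G where "G = F - {{}}"
  have G: "finite G" "G \<subseteq> \<A> - {{}}" using assms by (auto simp: G_def)
  have sum_G: "(\<Sum>D\<in>F. c D * h D) = (\<Sum>D\<in>G. c D * h D)" if "h {} = 0" for h :: "'t set \<Rightarrow> real"
    by (rule sum.mono_neutral_right) (use that assms(1) in \<open>auto simp: G_def\<close>)
  obtain S n A where S: "finite_subsemilattice \<A> S" and A: "consistent_ordering \<A> S n A" and "G \<subseteq> S"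
    using ordering_for[OF G] by metis
  have zero': "(\<Sum>D\<in>G. c D * indicator D t) = (0 :: real)" for t
    using zero[of t] sum_G[of "\<lambda>D. indicator D t"] by simp
  have R: "{z \<in> space (PiM S (\<lambda>_. borel)). (\<Sum>D\<in>G. c D * z D) = 0} \<in> sets (PiM S (\<lambda>_. borel))"
  proof -
    have "(\<lambda>z. \<Sum>D\<in>G. c D * z D) \<in> borel_measurable (PiM S (\<lambda>_. borel))"
      by (intro borel_measurable_sum borel_measurable_times borel_measurable_const
          measurable_component_singleton) (use \<open>G \<subseteq> S\<close> in auto)
    then show ?thesis by measurable
  qed
  have restr: "(\<Sum>D\<in>G. c D * (\<lambda>B\<in>S. h B) D) = (\<Sum>D\<in>G. c D * h D)" for h :: "'t set \<Rightarrow> real"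
    by (rule sum.cong) (use \<open>G \<subseteq> S\<close> in auto)
  have "AE x in path_law A n. (\<Sum>D\<in>G. c D * set_value A n x D) = 0"
    using combination_path[OF S A \<open>G \<subseteq> S\<close>, of c] by (simp add: zero')
  then have "AE \<omega> in limit_law. (\<Sum>D\<in>G. c D * process D \<omega>) = 0"
    using AE_process_iff[OF S A R] unfolding restr by simp
  moreover have "(\<Sum>D\<in>F. c D * process D \<omega>) = (\<Sum>D\<in>G. c D * process D \<omega>)" for \<omega>
    by (rule sum_G) (simp add: process_def)
  ultimately show ?thesis by simp
qed

lemma additive_process: "additive_ext_diff_unions limit_law \<A> process"
  by (rule additive_ext_diff_unionsI[OF Inter_in empty_in linear_relation])

end

section \<open>The Markov property\<close>

text \<open>The functions \<open>f\<close> and \<open>g\<close> are the densities of two finite measures that agree on an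
  intersection-stable generator.\<close>

lemma nn_integral_eq_on_generated:
  assumes "prob_space M"
    and f: "f \<in> borel_measurable M" "\<And>\<omega>. f \<omega> \<le> 1" and g: "g \<in> borel_measurable M"
    and \<G>: "\<G> \<subseteq> sets M" "Int_stable \<G>" "space M \<in> \<G>"
    and eq: "\<And>E. E \<in> \<G> \<Longrightarrow> (\<integral>\<^sup>+\<omega>. f \<omega> * indicator E \<omega> \<partial>M) = (\<integral>\<^sup>+\<omega>. g \<omega> * indicator E \<omega> \<partial>M)"
    and E: "E \<in> sigma_sets (space M) \<G>"
  shows "(\<integral>\<^sup>+\<omega>. f \<omega> * indicator E \<omega> \<partial>M) = (\<integral>\<^sup>+\<omega>. g \<omega> * indicator E \<omega> \<partial>M)"
proof -
  interpret prob_space M by fact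
  have pow: "\<G> \<subseteq> Pow (space M)" using \<G>(1) sets.space_closed by blast
  define N where "N = sigma (space M) \<G>"
  have sets_N: "sets N = sigma_sets (space M) \<G>" and space_N: "space N = space M"
    unfolding N_def using pow by simp_all
  have sub: "sigma_sets (space M) \<G> \<subseteq> sets M" using \<G>(1) by (rule sets.sigma_sets_subset)
  have em: "emeasure (distr (density M h) N (\<lambda>x. x)) D = (\<integral>\<^sup>+\<omega>. h \<omega> * indicator D \<omega> \<partial>M)"
    if h: "h \<in> borel_measurable M" and D: "D \<in> sigma_sets (space M) \<G>" for h D
  proof -
    have DM: "D \<in> sets M" using D sub by auto
    have "(\<lambda>x. x) \<in> density M h \<rightarrow>\<^sub>M N"
    proof (rule measurableI)
      fix B assume "B \<in> sets N"
      then have "B \<in> sets M" using sub sets_N by auto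
      then have "(\<lambda>x. x) -` B \<inter> space (density M h) = B" using sets.sets_into_space by auto
      then show "(\<lambda>x. x) -` B \<inter> space (density M h) \<in> sets (density M h)"
        using \<open>B \<in> sets M\<close> by simp
    qed (simp add: space_N)
    moreover have "(\<lambda>x. x) -` D \<inter> space (density M h) = D"
      using sets.sets_into_space[OF DM] by auto
    ultimately show ?thesis
      using D h DM by (simp add: emeasure_distr sets_N emeasure_density)
  qed
  have "distr (density M f) N (\<lambda>x. x) = distr (density M g) N (\<lambda>x. x)"
  proof (rule measure_eqI_generator_eq[OF \<G>(2) pow])
    show "emeasure (distr (density M f) N (\<lambda>x. x)) X = emeasure (distr (density M g) N (\<lambda>x. x)) X"
      if "X \<in> \<G>" for X
      using em[OF f(1), of X] em[OF g, of X] eq[OF that] that by simp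
    show "range (\<lambda>i::nat. space M) \<subseteq> \<G>" using \<G>(3) by auto
    have "(\<integral>\<^sup>+\<omega>. f \<omega> * indicator (space M) \<omega> \<partial>M) \<le> (\<integral>\<^sup>+\<omega>. 1 \<partial>M)"
      by (rule nn_integral_mono) (use f(2) in \<open>auto simp: indicator_def\<close>)
    also have "\<dots> = 1" by (simp add: emeasure_space_1)
    finally have "(\<integral>\<^sup>+\<omega>. f \<omega> * indicator (space M) \<omega> \<partial>M) < \<top>"
      by (rule order_le_less_trans) simp
    then show "emeasure (distr (density M f) N (\<lambda>x. x)) (space M) \<noteq> \<infinity>" for i :: nat
      using em[OF f(1), of "space M"] \<G>(3) by simp
  qed (simp_all add: sets_N)
  then show ?thesis using em[OF f(1) E] em[OF g E] by simp
qed

context consistent_transition_system begin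

text \<open>If the sets inside \<open>D\<close> have key at most \<open>k\<close>, their increments occur before the end of that
  block.\<close>

lemma set_value_stop:
  assumes A: "consistent_ordering \<A> S n A" and b: "mono_on {1..n} (b \<circ> A)"
    and D: "\<And>i. i \<in> {1..n} \<Longrightarrow> A i \<subseteq> D \<Longrightarrow> b (A i) \<le> k"
  shows "set_value A n (stop_path (block_end S b k) x) D = set_value A n x D"
  unfolding set_value_def
proof (rule sum.cong[OF refl])
  fix i assume "i \<in> {i. i \<in> {1..n} \<and> A i \<subseteq> D}"
  then have "i \<in> {i\<in>{1..n}. b (A i) \<le> k}" using D by auto
  then have "i \<le> block_end S b k" unfolding block_indices[OF A b] by auto
  then show "increment (stop_path (block_end S b k) x) i = increment x i"
    by (auto simp: increment_def stop_path_def)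
qed

lemma union_value_path:
  assumes S: "finite_subsemilattice \<A> S" and A: "consistent_ordering \<A> S n A"
    and F: "F \<subseteq> S" and ind: "\<And>t. (\<Sum>D\<in>F. c D * indicator D t) = (indicator (\<Union>G) t :: real)"
    and G: "G \<subseteq> S"
  shows "AE x in path_law A n. (\<Sum>D\<in>F. c D * set_value A n x D) = set_value A n x (\<Union>G)"
  using combination_path[OF S A F, of c] set_value_point_masses[OF S A]
proof eventually_elim
  case (elim x)
  then show ?case using G by (simp only: ind)
qed

lemma nn_integral_process:
  assumes S: "finite_subsemilattice \<A> S" and A: "consistent_ordering \<A> S n A"
    and h: "h \<in> borel_measurable (PiM S (\<lambda>_. borel))"
  shows "(\<integral>\<^sup>+\<omega>. h (\<lambda>B\<in>S. process B \<omega>) \<partial>limit_law) = (\<integral>\<^sup>+x. h (\<lambda>B\<in>S. set_value A n x B) \<partial>path_law A n)"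
proof -
  have "S \<subseteq> \<A>" using S by (simp add: finite_subsemilattice_def)
  then have m: "(\<lambda>\<omega>. \<lambda>B\<in>S. process B \<omega>) \<in> limit_law \<rightarrow>\<^sub>M PiM S (\<lambda>_. borel)"
    by (intro measurable_restrict measurable_process) auto
  have m': "(\<lambda>x. \<lambda>B\<in>S. set_value A n x B) \<in> path_law A n \<rightarrow>\<^sub>M PiM S (\<lambda>_. borel)"
    unfolding measurable_path_law[OF S A] by (rule measurable_set_values)
  have "(\<integral>\<^sup>+\<omega>. h (\<lambda>B\<in>S. process B \<omega>) \<partial>limit_law) =
      (\<integral>\<^sup>+z. h z \<partial>distr limit_law (PiM S (\<lambda>_. borel)) (\<lambda>\<omega>. \<lambda>B\<in>S. process B \<omega>))"
    by (rule nn_integral_distr[OF m, symmetric]) (use h in simp)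
  also have "\<dots> = (\<integral>\<^sup>+z. h z \<partial>joint_law A n S)"
    unfolding process_law[OF S A order_refl] ..
  also have "\<dots> = (\<integral>\<^sup>+x. h (\<lambda>B\<in>S. set_value A n x B) \<partial>path_law A n)"
    unfolding joint_law_def by (rule nn_integral_distr[OF m']) (use h in simp)
  finally show ?thesis .
qed

lemma kernel_measurable:
  assumes "B \<in> fin_unions \<A> - {{}}" "B' \<in> fin_unions \<A> - {{}}" "B \<subseteq> B'"
  shows "Q B B' \<in> borel \<rightarrow>\<^sub>M prob_algebra borel"
  by (rule transition_system[unfolded transition_system_def, THEN conjunct1, rule_format, OF assms])

lemma fin_unions_nonempty_members:
  assumes "B \<in> fin_unions \<A>"
  obtains G where "finite G" "G \<subseteq> \<A> - {{}}" "B = \<Union>G"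
proof -
  obtain F where "finite F" "F \<subseteq> \<A>" "B = \<Union>F" using assms by (auto simp: fin_unions_def)
  then show ?thesis using that[of "F - {{}}"] by auto
qed

lemma ext_unions_representation:
  assumes "B \<in> fin_unions \<A>"
  obtains F c where "finite F" "F \<subseteq> \<A> - {{}}" "\<And>t. (\<Sum>D\<in>F. c D * indicator D t) = (indicator B t :: real)"
    "\<And>\<omega>. ext_unions \<A> process B \<omega> = (\<Sum>D\<in>F. c D * process D \<omega>)"
proof -
  obtain F c where F: "finite F" "F \<subseteq> \<A>" "\<And>\<omega>. ext_unions \<A> process B \<omega> = (\<Sum>D\<in>F. c D * process D \<omega>)"
      "\<And>t. (indicator B t :: real) = (\<Sum>D\<in>F. c D * indicator D t)"
    using combination_ext_unions'[OF Inter_in empty_in assms, of process] unfolding combination_def by blast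
  have *: "(\<Sum>D\<in>F. c D * h D) = (\<Sum>D\<in>F - {{}}. c D * h D)" if "h {} = 0" for h :: "'t set \<Rightarrow> real"
    by (rule sum.mono_neutral_right) (use that F(1) in auto)
  show ?thesis
  proof (rule that[of "F - {{}}" c])
    show "(\<Sum>D\<in>F - {{}}. c D * indicator D t) = (indicator B t :: real)" for t
      unfolding F(4) by (rule *[symmetric]) simp
    show "ext_unions \<A> process B \<omega> = (\<Sum>D\<in>F - {{}}. c D * process D \<omega>)" for \<omega>
      unfolding F(3) by (rule *) (simp add: process_def)
  qed (use F(1,2) in auto)
qed

text \<open>The semilattice contains the sets of \<open>J\<close>, the members of \<open>B\<close> and \<open>B'\<close>, and all the sets that
  occur in the chosen representations of the values at \<open>B\<close> and \<open>B'\<close>. It is ordered so that the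
  sets inside \<open>B\<close> come first and those inside \<open>B'\<close> next, with the blocks ending at \<open>p\<close> and \<open>q\<close>.
  Then the claim is the jump of the chain from time \<open>p\<close> to time \<open>q\<close>.\<close>

lemma markov_on_cylinders:
  assumes B: "B \<in> fin_unions \<A> - {{}}" and B': "B' \<in> fin_unions \<A> - {{}}" and "B \<subseteq> B'"
    and \<Gamma>: "\<Gamma> \<in> sets borel"
    and J: "finite J" "\<And>D. D \<in> J \<Longrightarrow> D \<in> \<A> \<and> D \<noteq> {} \<and> D \<subseteq> B" "\<And>D. D \<in> J \<Longrightarrow> \<Lambda> D \<in> sets borel"
  shows "(\<integral>\<^sup>+\<omega>. (\<Prod>D\<in>J. indicator (\<Lambda> D) (process D \<omega>)) * indicator \<Gamma> (ext_unions \<A> process B' \<omega>) \<partial>limit_law) =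
    (\<integral>\<^sup>+\<omega>. (\<Prod>D\<in>J. indicator (\<Lambda> D) (process D \<omega>)) * emeasure (Q B B' (ext_unions \<A> process B \<omega>)) \<Gamma> \<partial>limit_law)"
proof -
  have BU: "B \<in> fin_unions \<A>" and BU': "B' \<in> fin_unions \<A>" using B B' by auto
  obtain F c where F: "finite F" "F \<subseteq> \<A> - {{}}" "\<And>t. (\<Sum>D\<in>F. c D * indicator D t) = (indicator B t :: real)"
    "\<And>\<omega>. ext_unions \<A> process B \<omega> = (\<Sum>D\<in>F. c D * process D \<omega>)"
    by (rule ext_unions_representation[OF BU], rule that)
  obtain F' c' where F': "finite F'" "F' \<subseteq> \<A> - {{}}" "\<And>t. (\<Sum>D\<in>F'. c' D * indicator D t) = (indicator B' t :: real)"
    "\<And>\<omega>. ext_unions \<A> process B' \<omega> = (\<Sum>D\<in>F'. c' D * process D \<omega>)"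
    by (rule ext_unions_representation[OF BU'], rule that)
  obtain G where G: "finite G" "G \<subseteq> \<A> - {{}}" "B = \<Union>G"
    by (rule fin_unions_nonempty_members[OF BU], rule that)
  obtain G' where G': "finite G'" "G' \<subseteq> \<A> - {{}}" "B' = \<Union>G'"
    by (rule fin_unions_nonempty_members[OF BU'], rule that)
  have "finite (J \<union> F \<union> F' \<union> G \<union> G')" "J \<union> F \<union> F' \<union> G \<union> G' \<subseteq> \<A> - {{}}"
    using J F F' G G' by auto
  then obtain S where S: "finite_subsemilattice \<A> S" and sub: "J \<union> F \<union> F' \<union> G \<union> G' \<subseteq> S"
    and min: "min_set \<A> \<in> S"
    using finite_subsemilattice_generated by metis
  have fin: "finite S" using S by (simp add: finite_subsemilattice_def)
  \<comment> \<open>The key that puts the sets inside \<open>B\<close> first and those inside \<open>B'\<close> second.\<close>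
  define b where "b D = (if D \<subseteq> B then 0 else if D \<subseteq> B' then 1 else 2 :: nat)" for D
  obtain A where A: "consistent_ordering \<A> S (card S) A" and mono: "mono_on {1..card S} (b \<circ> A)"
    by (rule consistent_ordering_exists[OF S, of b]) (use \<open>B \<subseteq> B'\<close> in \<open>auto simp: b_def\<close>)
  let ?n = "card S"
  define p where "p = block_end S b 0"
  define q where "q = block_end S b 1"
  have b0: "b D \<le> 0 \<longleftrightarrow> D \<subseteq> B" and b1: "b D \<le> 1 \<longleftrightarrow> D \<subseteq> B'" for D
    using \<open>B \<subseteq> B'\<close> by (auto simp: b_def)
  have pq: "p \<le> q" "q \<le> ?n"
    unfolding p_def q_def by (auto intro: block_end_mono[OF fin] block_end_le[OF fin])
  obtain D0 where "D0 \<in> G" using B G by auto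
  then have min_B: "min_set \<A> \<subseteq> B" using min_set_subset[of D0] G by auto
  \<comment> \<open>Position \<open>0\<close> carries no increment, so the sum over the block of \<open>B\<close> is \<open>x p\<close> only if \<open>p\<close> is positive.\<close>
  have p_pos: "p \<noteq> 0"
  proof -
    have "min_set \<A> \<in> {D\<in>S. b D \<le> 0}" unfolding mem_Collect_eq b0 using min min_B by blast
    then show ?thesis unfolding p_def block_end_def using fin by auto
  qed
  have U_p: "(\<Union>l\<le>p. A l) = B"
    unfolding p_def Union_block[OF S A mono] b0 using min_B G sub by auto
  have U_q: "(\<Union>l\<le>q. A l) = B'"
    unfolding q_def Union_block[OF S A mono] b1
    using min_B \<open>B \<subseteq> B'\<close> G' sub by auto
  have value_B: "set_value A ?n x B = x p" for x
    using sum_increment_block[OF A mono, of 0 x] p_pos unfolding b0 set_value_def p_def by simp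
  have value_B': "set_value A ?n x B' = x q" for x
    using sum_increment_block[OF A mono, of 1 x] p_pos pq unfolding b1 set_value_def q_def by simp
  interpret C: inhomogeneous_chain \<mu> "chain_kernel A" ?n by (rule ordering_chain[OF S A])
  define e where "e z = (\<Prod>D\<in>J. indicator (\<Lambda> D) (z D) :: ennreal)" for z :: "'t set \<Rightarrow> real"
  define s where "s F c z = (\<Sum>D\<in>F. c D * z D)" for F c and z :: "'t set \<Rightarrow> real"
  have e: "e \<in> borel_measurable (PiM S (\<lambda>_. borel))"
    unfolding e_def
  proof (rule borel_measurable_prod_ennreal)
    fix D assume D: "D \<in> J"
    have "(\<lambda>z. z D) \<in> borel_measurable (PiM S (\<lambda>_. borel))"
      by (rule measurable_component_singleton) (use D sub in auto)
    then show "(\<lambda>z. indicator (\<Lambda> D) (z D) :: ennreal) \<in> borel_measurable (PiM S (\<lambda>_. borel))"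
      by (rule measurable_compose[OF _ borel_measurable_indicator[OF J(3)[OF D]]])
  qed
  have s: "s H c \<in> borel_measurable (PiM S (\<lambda>_. borel))" if "H \<subseteq> S" for H c
    unfolding s_def
    by (intro borel_measurable_sum borel_measurable_times borel_measurable_const
        measurable_component_singleton) (use that in auto)
  have e_cong: "e (\<lambda>D\<in>S. h D) = e h" for h
    unfolding e_def by (rule prod.cong) (use sub in auto)
  have s_cong: "s H c (\<lambda>D\<in>S. h D) = s H c h" if "H \<subseteq> S" for H c h
    unfolding s_def by (rule sum.cong) (use that in auto)
  have QB: "(\<lambda>x. emeasure (Q B B' x) \<Gamma>) \<in> borel_measurable borel"
    using measurable_compose[OF measurable_prob_algebraD[OF kernel_measurable[OF B B' \<open>B \<subseteq> B'\<close>]]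
        measurable_emeasure_subprob_algebra[OF \<Gamma>]] .
  have sF: "F \<subseteq> S" and sF': "F' \<subseteq> S" using sub by auto
  have at_B: "AE x in path_law A ?n. s F c (set_value A ?n x) = x p"
    using union_value_path[OF S A sF F(3)[unfolded G(3)]] sub value_B unfolding s_def G(3) by simp
  have at_B': "AE x in path_law A ?n. s F' c' (set_value A ?n x) = x q"
    using union_value_path[OF S A sF' F'(3)[unfolded G'(3)]] sub value_B' unfolding s_def G'(3) by simp
  have e_stop: "e (set_value A ?n (stop_path p x)) = e (set_value A ?n x)" for x
    unfolding e_def
  proof (rule prod.cong[OF refl])
    fix D assume "D \<in> J"
    then have "D \<subseteq> B" using J(2) by blast
    then have "set_value A ?n (stop_path p x) D = set_value A ?n x D"
      unfolding p_def by (intro set_value_stop[OF A mono]) (unfold b0, blast)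
    then show "indicator (\<Lambda> D) (set_value A ?n (stop_path p x) D) =
        (indicator (\<Lambda> D) (set_value A ?n x D) :: ennreal)" by simp
  qed
  have e_path: "(\<lambda>x. e (set_value A ?n x)) \<in> borel_measurable path_space"
    using measurable_compose[OF measurable_set_values e] unfolding e_cong .
  define f where "f x y = e (set_value A ?n x) * indicator \<Gamma> y" for x y
  have f: "case_prod f \<in> borel_measurable (path_space \<Otimes>\<^sub>M borel)"
    unfolding f_def case_prod_unfold
    by (intro borel_measurable_times_ennreal measurable_compose[OF measurable_fst e_path]
        measurable_compose[OF measurable_snd borel_measurable_indicator[OF \<Gamma>]])
  have h: "(\<lambda>z. e z * indicator \<Gamma> (s F' c' z)) \<in> borel_measurable (PiM S (\<lambda>_. borel))"
    by (intro borel_measurable_times_ennreal e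
        measurable_compose[OF s[OF sF'] borel_measurable_indicator[OF \<Gamma>]])
  have h': "(\<lambda>z. e z * emeasure (Q B B' (s F c z)) \<Gamma>) \<in> borel_measurable (PiM S (\<lambda>_. borel))"
    by (intro borel_measurable_times_ennreal e measurable_compose[OF s[OF sF] QB])
  have "(\<integral>\<^sup>+\<omega>. e (\<lambda>D. process D \<omega>) * indicator \<Gamma> (s F' c' (\<lambda>D. process D \<omega>)) \<partial>limit_law) =
      (\<integral>\<^sup>+x. e (set_value A ?n x) * indicator \<Gamma> (s F' c' (set_value A ?n x)) \<partial>path_law A ?n)"
    using nn_integral_process[OF S A h] unfolding e_cong s_cong[OF sF'] .
  also have "\<dots> = (\<integral>\<^sup>+x. f (stop_path p x) (x q) \<partial>path_law A ?n)"
    by (rule nn_integral_cong_AE, use at_B' in eventually_elim) (simp add: f_def e_stop)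
  also have "\<dots> = (\<integral>\<^sup>+x. (\<integral>\<^sup>+y. f (stop_path p x) y \<partial>chain_kernel A p q (x p)) \<partial>path_law A ?n)"
    unfolding path_law_def by (rule C.nn_integral_jump_within[OF pq f])
  also have "\<dots> = (\<integral>\<^sup>+x. e (set_value A ?n x) * emeasure (Q B B' (x p)) \<Gamma> \<partial>path_law A ?n)"
  proof (rule nn_integral_cong)
    fix x
    have "\<Gamma> \<in> sets (chain_kernel A p q (x p))" using C.kernel_in(2)[OF pq] \<Gamma> by simp
    from nn_integral_cmult_indicator[OF this]
    show "(\<integral>\<^sup>+y. f (stop_path p x) y \<partial>chain_kernel A p q (x p)) =
        e (set_value A ?n x) * emeasure (Q B B' (x p)) \<Gamma>"
      unfolding f_def e_stop chain_kernel_def U_p U_q .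
  qed
  also have "\<dots> = (\<integral>\<^sup>+x. e (set_value A ?n x) * emeasure (Q B B' (s F c (set_value A ?n x))) \<Gamma> \<partial>path_law A ?n)"
    by (rule nn_integral_cong_AE, use at_B in eventually_elim) simp
  also have "\<dots> = (\<integral>\<^sup>+\<omega>. e (\<lambda>D. process D \<omega>) * emeasure (Q B B' (s F c (\<lambda>D. process D \<omega>))) \<Gamma> \<partial>limit_law)"
    using nn_integral_process[OF S A h'] unfolding e_cong s_cong[OF sF] by simp
  finally show ?thesis unfolding e_def s_def F(4) F'(4) .
qed

lemma measurable_process_filtration:
  assumes "D \<in> \<A>" "D \<subseteq> B"
  shows "process D \<in> borel_measurable (minimal_filtration limit_law \<A> process B)"
    and "subalgebra limit_law (minimal_filtration limit_law \<A> process B)"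
proof -
  let ?gen = "{process A -` \<Gamma> \<inter> space limit_law | A \<Gamma>. A \<in> \<A> \<and> A \<subseteq> B \<and> \<Gamma> \<in> sets borel}
    \<union> null_sets limit_law"
  have gen: "?gen \<subseteq> sets limit_law"
    using measurable_process by (auto intro: measurable_sets)
  then have pow: "?gen \<subseteq> Pow (space limit_law)" using sets.space_closed by blast
  have sp: "space (minimal_filtration limit_law \<A> process B) = space limit_law"
    unfolding minimal_filtration_def by (rule space_measure_of[OF pow])
  have st: "sets (minimal_filtration limit_law \<A> process B) = sigma_sets (space limit_law) ?gen"
    unfolding minimal_filtration_def by (rule sets_measure_of[OF pow])
  show "subalgebra limit_law (minimal_filtration limit_law \<A> process B)"
    unfolding subalgebra_def sp st using sets.sigma_sets_subset[OF gen] by simp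
  show "process D \<in> borel_measurable (minimal_filtration limit_law \<A> process B)"
    by (rule measurableI) (use assms in \<open>auto simp: sp st\<close>)
qed

text \<open>The conditional expectation is characterised by its integrals over the events of the filtration.
  The class \<open>\<G>\<close> of events that agree with a cylinder up to a null set is stable under
  intersections and contains both kinds of generators of the filtration. The null sets are covered by
  a cylinder with empty base.\<close>

lemma markov_property:
  assumes B: "B \<in> fin_unions \<A> - {{}}" and B': "B' \<in> fin_unions \<A> - {{}}" and "B \<subseteq> B'"
    and \<Gamma>: "\<Gamma> \<in> sets borel"
  shows "AE \<omega> in limit_law.
    real_cond_exp limit_law (minimal_filtration limit_law \<A> process B)
      (\<lambda>\<omega>. indicator \<Gamma> (ext_unions \<A> process B' \<omega>)) \<omega>
    = measure (Q B B' (ext_unions \<A> process B \<omega>)) \<Gamma>"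
proof -
  interpret prob_space limit_law by (rule prob_space_limit_law)
  let ?F = "minimal_filtration limit_law \<A> process B"
  let ?X = "ext_unions \<A> process"
  have sub: "subalgebra limit_law ?F"
    by (rule measurable_process_filtration(2)[OF empty_in]) simp
  interpret finite_measure_subalgebra limit_law ?F
    by unfold_locales (rule sub)
  have X_meas: "?X C \<in> borel_measurable limit_law" if "C \<in> fin_unions \<A>" for C
    by (rule combination_measurable[OF combination_ext_unions'[OF Inter_in empty_in that] measurable_process])
  have X_F: "?X B \<in> borel_measurable ?F"
    by (rule combination_measurable[OF combination_ext_unions[OF Inter_in empty_in]])
      (use B measurable_process_filtration(1) in auto)
  note kernel = kernel_measurable[OF B B' \<open>B \<subseteq> B'\<close>]
  have prob: "prob_space (Q B B' x)" for x
    using measurable_space[OF kernel, of x] by (simp add: space_prob_algebra)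
  define f where "f \<omega> = (indicator \<Gamma> (?X B' \<omega>) :: real)" for \<omega>
  define g where "g \<omega> = measure (Q B B' (?X B \<omega>)) \<Gamma>" for \<omega>
  have f: "f \<in> borel_measurable limit_law"
    unfolding f_def
    by (rule measurable_compose[OF X_meas borel_measurable_indicator[OF \<Gamma>]]) (use B' in simp)
  have g_F: "g \<in> borel_measurable ?F"
    unfolding g_def
    by (rule measurable_compose[OF X_F
          measurable_compose[OF kernel measurable_measure_prob_algebra[OF \<Gamma>]]])
  have g: "g \<in> borel_measurable limit_law" by (rule measurable_from_subalg[OF sub g_F])
  have f01: "0 \<le> f \<omega>" "f \<omega> \<le> 1" for \<omega> by (auto simp: f_def)
  have g01: "0 \<le> g \<omega>" "g \<omega> \<le> 1" for \<omega>
    unfolding g_def using prob_space.prob_le_1[OF prob] by auto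
  have em: "emeasure (Q B B' (?X B \<omega>)) \<Gamma> = ennreal (g \<omega>)" for \<omega>
    unfolding g_def
    by (rule finite_measure.emeasure_eq_measure, rule prob_space.finite_measure, rule prob)
  define cylinder where "cylinder J \<Lambda> = {\<omega>\<in>space limit_law. \<forall>D\<in>J. process D \<omega> \<in> \<Lambda> D}"
    for J :: "'t set set" and \<Lambda> :: "'t set \<Rightarrow> real set"
  define valid where "valid J \<Lambda> \<longleftrightarrow> finite J \<and> (\<forall>D\<in>J. D \<in> \<A> \<and> D \<noteq> {} \<and> D \<subseteq> B) \<and>
    (\<forall>D. \<Lambda> D \<in> sets borel)" for J :: "'t set set" and \<Lambda> :: "'t set \<Rightarrow> real set"
  define \<G> where "\<G> = {E \<in> sets limit_law. \<exists>J \<Lambda>. valid J \<Lambda> \<and>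
    (AE \<omega> in limit_law. \<omega> \<in> E \<longleftrightarrow> \<omega> \<in> cylinder J \<Lambda>)}"
  have eq_\<G>: "(\<integral>\<^sup>+\<omega>. ennreal (f \<omega>) * indicator E \<omega> \<partial>limit_law) =
      (\<integral>\<^sup>+\<omega>. ennreal (g \<omega>) * indicator E \<omega> \<partial>limit_law)" if EG: "E \<in> \<G>" for E
  proof -
    obtain J \<Lambda> where J: "valid J \<Lambda>" and AE: "AE \<omega> in limit_law. \<omega> \<in> E \<longleftrightarrow> \<omega> \<in> cylinder J \<Lambda>"
      using EG unfolding \<G>_def by blast
    have ind: "AE \<omega> in limit_law. indicator E \<omega> = (\<Prod>D\<in>J. indicator (\<Lambda> D) (process D \<omega>) :: ennreal)"
      using AE AE_space
    proof eventually_elim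
      case (elim \<omega>)
      have "finite J" using J by (simp add: valid_def)
      then have "(\<Prod>D\<in>J. indicator (\<Lambda> D) (process D \<omega>) :: ennreal) =
          (if \<forall>D\<in>J. process D \<omega> \<in> \<Lambda> D then 1 else 0)"
        by (induction J rule: finite_induct) auto
      then show ?case using elim by (auto simp: cylinder_def indicator_def)
    qed
    have "(\<integral>\<^sup>+\<omega>. ennreal (f \<omega>) * indicator E \<omega> \<partial>limit_law) =
        (\<integral>\<^sup>+\<omega>. (\<Prod>D\<in>J. indicator (\<Lambda> D) (process D \<omega>)) * indicator \<Gamma> (?X B' \<omega>) \<partial>limit_law)"
      by (rule nn_integral_cong_AE, use ind in eventually_elim)
        (simp add: f_def mult.commute ennreal_indicator)
    also have "\<dots> = (\<integral>\<^sup>+\<omega>. (\<Prod>D\<in>J. indicator (\<Lambda> D) (process D \<omega>)) *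
        emeasure (Q B B' (?X B \<omega>)) \<Gamma> \<partial>limit_law)"
      by (rule markov_on_cylinders[OF B B' \<open>B \<subseteq> B'\<close> \<Gamma>]) (use J in \<open>auto simp: valid_def\<close>)
    also have "\<dots> = (\<integral>\<^sup>+\<omega>. ennreal (g \<omega>) * indicator E \<omega> \<partial>limit_law)"
      unfolding em by (rule nn_integral_cong_AE, use ind in eventually_elim) (simp add: mult.commute)
    finally show ?thesis .
  qed
  have valid_empty: "valid {} (\<lambda>_. UNIV)" by (simp add: valid_def)
  have space_\<G>: "space limit_law \<in> \<G>"
    unfolding \<G>_def using valid_empty AE_space
    by (intro CollectI conjI exI[of _ "{}"] exI[of _ "\<lambda>_. UNIV"]) (auto simp: cylinder_def)
  have null_\<G>: "E \<in> \<G>" if "E \<in> null_sets limit_law" for E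
  proof -
    have BU: "B \<in> fin_unions \<A>" using B by simp
    obtain G where G: "G \<subseteq> \<A> - {{}}" "B = \<Union>G"
      by (rule fin_unions_nonempty_members[OF BU], rule that)
    then obtain D where "D \<in> G" using B by auto
    then have D: "D \<in> \<A>" "D \<noteq> {}" "D \<subseteq> B" using G by auto
    then have "valid {D} (\<lambda>_. {})" by (simp add: valid_def)
    moreover have "cylinder {D} (\<lambda>_. {}) = {}" by (simp add: cylinder_def)
    ultimately show ?thesis
      unfolding \<G>_def using that AE_not_in[OF that]
      by (intro CollectI conjI exI[of _ "{D}"] exI[of _ "\<lambda>_. {}"]) (auto simp: null_sets_def)
  qed
  have stable: "Int_stable \<G>"
  proof (rule Int_stableI)
    fix E E' assume "E \<in> \<G>" "E' \<in> \<G>"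
    then obtain J \<Lambda> J' \<Lambda>' where *: "E \<in> sets limit_law" "E' \<in> sets limit_law" "valid J \<Lambda>" "valid J' \<Lambda>'"
      "AE \<omega> in limit_law. \<omega> \<in> E \<longleftrightarrow> \<omega> \<in> cylinder J \<Lambda>"
      "AE \<omega> in limit_law. \<omega> \<in> E' \<longleftrightarrow> \<omega> \<in> cylinder J' \<Lambda>'"
      unfolding \<G>_def by blast
    define \<Lambda>'' where "\<Lambda>'' D = (if D \<in> J then \<Lambda> D else UNIV) \<inter> (if D \<in> J' then \<Lambda>' D else UNIV)" for D
    have "valid (J \<union> J') \<Lambda>''" using *(3,4) unfolding valid_def \<Lambda>''_def by auto
    moreover have "cylinder (J \<union> J') \<Lambda>'' = cylinder J \<Lambda> \<inter> cylinder J' \<Lambda>'"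
      unfolding cylinder_def \<Lambda>''_def by auto
    moreover have "AE \<omega> in limit_law. \<omega> \<in> E \<inter> E' \<longleftrightarrow> \<omega> \<in> cylinder J \<Lambda> \<inter> cylinder J' \<Lambda>'"
      using *(5,6) by eventually_elim auto
    ultimately show "E \<inter> E' \<in> \<G>"
      unfolding \<G>_def using *(1,2)
      by (intro CollectI conjI exI[of _ "J \<union> J'"] exI[of _ \<Lambda>'']) auto
  qed
  have gen_\<G>: "process D -` \<Lambda> \<inter> space limit_law \<in> \<G>"
    if D: "D \<in> \<A>" "D \<subseteq> B" and \<Lambda>: "\<Lambda> \<in> sets borel" for D \<Lambda>
  proof (cases "D = {}")
    case True
    then have "process D -` \<Lambda> \<inter> space limit_law = (if 0 \<in> \<Lambda> then space limit_law else {})"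
      by (auto simp: process_def)
    then show ?thesis using space_\<G> null_\<G> by simp
  next
    case False
    have "valid {D} (\<lambda>_. \<Lambda>)" using D \<Lambda> False by (simp add: valid_def)
    moreover have "process D -` \<Lambda> \<inter> space limit_law = cylinder {D} (\<lambda>_. \<Lambda>)"
      by (auto simp: cylinder_def)
    moreover have "process D -` \<Lambda> \<inter> space limit_law \<in> sets limit_law"
      by (rule measurable_sets[OF measurable_process[OF D(1)] \<Lambda>])
    ultimately show ?thesis
      unfolding \<G>_def by (intro CollectI conjI exI[of _ "{D}"] exI[of _ "\<lambda>_. \<Lambda>"]) auto
  qed
  have \<G>_sets: "\<G> \<subseteq> sets limit_law" unfolding \<G>_def by auto
  have F_\<G>: "sets ?F \<subseteq> sigma_sets (space limit_law) \<G>"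
  proof -
    let ?gen = "{process A -` \<Gamma> \<inter> space limit_law | A \<Gamma>. A \<in> \<A> \<and> A \<subseteq> B \<and> \<Gamma> \<in> sets borel}
      \<union> null_sets limit_law"
    have "?gen \<subseteq> \<G>" using gen_\<G> null_\<G> by auto
    moreover from this have "?gen \<subseteq> Pow (space limit_law)" using \<G>_sets sets.space_closed by blast
    ultimately show ?thesis
      unfolding minimal_filtration_def by (simp add: sigma_sets_mono')
  qed
  have "AE \<omega> in limit_law. real_cond_exp limit_law ?F f \<omega> = g \<omega>"
  proof (rule real_cond_exp_charact)
    show "integrable limit_law f" "integrable limit_law g"
      using f g f01 g01 by (auto intro!: integrable_const_bound[of _ 1])
    show "g \<in> borel_measurable ?F" by (rule g_F)
    fix E assume "E \<in> sets ?F"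
    then have E: "E \<in> sigma_sets (space limit_law) \<G>" using F_\<G> by auto
    then have EM: "E \<in> sets limit_law" using sets.sigma_sets_subset[OF \<G>_sets] by auto
    have nn: "(\<integral>\<omega>\<in>E. h \<omega> \<partial>limit_law) = enn2real (\<integral>\<^sup>+\<omega>. ennreal (h \<omega>) * indicator E \<omega> \<partial>limit_law)"
      if h: "h \<in> borel_measurable limit_law" "\<And>\<omega>. 0 \<le> h \<omega>" for h
    proof -
      have "(\<integral>\<omega>\<in>E. h \<omega> \<partial>limit_law) = enn2real (\<integral>\<^sup>+\<omega>. ennreal (indicator E \<omega> *\<^sub>R h \<omega>) \<partial>limit_law)"
        unfolding set_lebesgue_integral_def
        by (rule integral_eq_nn_integral) (use h EM in auto)
      also have "(\<integral>\<^sup>+\<omega>. ennreal (indicator E \<omega> *\<^sub>R h \<omega>) \<partial>limit_law) =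
          (\<integral>\<^sup>+\<omega>. ennreal (h \<omega>) * indicator E \<omega> \<partial>limit_law)"
        by (rule nn_integral_cong) (auto simp: indicator_def)
      finally show ?thesis .
    qed
    have "(\<integral>\<^sup>+\<omega>. ennreal (f \<omega>) * indicator E \<omega> \<partial>limit_law) =
        (\<integral>\<^sup>+\<omega>. ennreal (g \<omega>) * indicator E \<omega> \<partial>limit_law)"
      by (rule nn_integral_eq_on_generated[OF prob_space_limit_law _ _ _ \<G>_sets stable space_\<G> eq_\<G> E])
        (use f g f01 in auto)
    then show "(\<integral>\<omega>\<in>E. f \<omega> \<partial>limit_law) = (\<integral>\<omega>\<in>E. g \<omega> \<partial>limit_law)"
      using nn[OF f f01(1)] nn[OF g g01(1)] by simp
  qed
  then show ?thesis unfolding f_def g_def .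
qed

text \<open>In the semilattice with the single member \<open>min_set \<A>\<close>, the first step of the chain goes from
  \<open>min_set \<A>\<close> to itself, so \<open>x 1\<close> has the law of \<open>x 0\<close>.\<close>

lemma initial_law: "distr limit_law borel (process (min_set \<A>)) = \<mu>"
proof -
  let ?S = "{min_set \<A>}"
  have S: "finite_subsemilattice \<A> ?S"
    using min_set_in min_set_nonempty by (auto simp: finite_subsemilattice_def)
  obtain A where "consistent_ordering \<A> ?S (card ?S) A"
    using consistent_ordering_exists[OF S, of "\<lambda>_. 0"] by auto
  then have A: "consistent_ordering \<A> ?S 1 A" by simp
  then have A01: "A 0 = min_set \<A>" "A 1 = min_set \<A>" by (auto simp: consistent_ordering_def)
  interpret C: inhomogeneous_chain \<mu> "chain_kernel A" 1 by (rule ordering_chain[OF S A])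
  have "chain_kernel A 0 1 = chain_kernel A 0 0" using A01 by (simp add: chain_kernel_def atMost_Suc)
  then have stay: "chain_kernel A 0 1 x = return borel x" for x using C.kernel_refl[of 0 x] by simp
  have val: "set_value A 1 x (min_set \<A>) = x 1" for x
  proof -
    have "{i. i \<in> {1..1} \<and> A i \<subseteq> min_set \<A>} = {1}" using A01 by auto
    then show ?thesis unfolding set_value_def by (simp add: increment_def)
  qed
  show ?thesis
  proof (rule measure_eqI)
    show "sets (distr limit_law borel (process (min_set \<A>))) = sets \<mu>" by (simp add: sets_init)
    fix \<Gamma> assume "\<Gamma> \<in> sets (distr limit_law borel (process (min_set \<A>)))"
    then have \<Gamma>: "\<Gamma> \<in> sets borel" by simp
    note ind = borel_measurable_indicator[OF \<Gamma>]
    define f where "f x y = (indicator \<Gamma> y :: ennreal)" for x :: "nat \<Rightarrow> real" and y :: real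
    have f: "case_prod f \<in> borel_measurable (path_space \<Otimes>\<^sub>M borel)"
      unfolding f_def case_prod_unfold by (rule measurable_compose[OF measurable_snd ind])
    have h: "(\<lambda>z. indicator \<Gamma> (z (min_set \<A>)) :: ennreal) \<in> borel_measurable (PiM ?S (\<lambda>_. borel))"
      by (rule measurable_compose[OF _ ind], rule measurable_component_singleton) simp
    have h0: "(\<lambda>x. indicator \<Gamma> (x 0) :: ennreal) \<in> borel_measurable path_space"
      by (rule measurable_compose[OF measurable_path_component ind])
    have "emeasure (distr limit_law borel (process (min_set \<A>))) \<Gamma> =
        (\<integral>\<^sup>+y. indicator \<Gamma> y \<partial>distr limit_law borel (process (min_set \<A>)))"
      by (rule nn_integral_indicator[symmetric]) (use \<Gamma> in simp)
    also have "\<dots> = (\<integral>\<^sup>+\<omega>. indicator \<Gamma> (process (min_set \<A>) \<omega>) \<partial>limit_law)"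
      by (rule nn_integral_distr[OF measurable_process[OF min_set_in]]) (use \<Gamma> in simp)
    also have "\<dots> = (\<integral>\<^sup>+x. indicator \<Gamma> (x 1) \<partial>path_law A 1)"
      using nn_integral_process[OF S A h] by (simp add: val[simplified])
    also have "\<dots> = (\<integral>\<^sup>+x. f (stop_path 0 x) (x (0 + 1)) \<partial>chain_law \<mu> (chain_kernel A) (0 + 1))"
      by (simp add: f_def path_law_def)
    also have "\<dots> = (\<integral>\<^sup>+x. (\<integral>\<^sup>+y. f (stop_path 0 x) y \<partial>chain_kernel A 0 (0 + 1) (x 0)) \<partial>chain_law \<mu> (chain_kernel A) 0)"
      by (rule C.nn_integral_jump[OF _ f]) simp
    also have "\<dots> = (\<integral>\<^sup>+x. indicator \<Gamma> (x 0) \<partial>chain_law \<mu> (chain_kernel A) 0)"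
      using stay \<Gamma> by (intro nn_integral_cong) (simp add: f_def)
    also have "\<dots> = (\<integral>\<^sup>+x. indicator \<Gamma> x \<partial>\<mu>)"
      using C.nn_integral_chain_law_0[OF h0] by (simp del: chain_law.simps)
    also have "\<dots> = emeasure \<mu> \<Gamma>"
      by (rule nn_integral_indicator) (use \<Gamma> sets_init in simp)
    finally show "emeasure (distr limit_law borel (process (min_set \<A>))) \<Gamma> = emeasure \<mu> \<Gamma>" .
  qed
qed

lemma Q_Markov_process: "Q_Markov limit_law \<A> Q process"
  unfolding Q_Markov_def set_indexed_process_def
proof (intro conjI ballI impI)
  show "prob_space limit_law" by (rule prob_space_limit_law)
  show "complete_measure limit_law"
    unfolding limit_law_def by (rule completion.complete_measure_axioms)
  show "process A \<in> borel_measurable limit_law" if "A \<in> \<A>" for A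
    by (rule measurable_process[OF that])
  show "additive_ext_diff_unions limit_law \<A> process" by (rule additive_process)
qed (rule markov_property)

end

theorem theorem1:
  fixes \<A> :: "'t::t2_space set set"
    and \<mu> :: "real measure"
    and Q :: "'t set \<Rightarrow> 't set \<Rightarrow> real \<Rightarrow> real measure"
  assumes "indexing_collection \<A>"
    and "prob_space \<mu>" and "sets \<mu> = sets borel"
    and "transition_system \<A> Q"
    and "\<And>\<A>' n A A' \<pi> \<Gamma>.
      finite_subsemilattice \<A> \<A>' \<Longrightarrow>
      consistent_ordering \<A> \<A>' n A \<Longrightarrow>
      consistent_ordering \<A> \<A>' n A' \<Longrightarrow>
      \<pi> permutes {1..n} \<Longrightarrow> \<pi> 1 = 1 \<Longrightarrow> (\<forall>i\<in>{1..n}. A i = A' (\<pi> i)) \<Longrightarrow>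
      (\<forall>i\<le>n. \<Gamma> i \<in> sets (borel :: real measure)) \<Longrightarrow>
      path_integral \<mu> Q A n
        (\<lambda>x. indicator (\<Gamma> 0) (x 0) * indicator (\<Gamma> 1) (x 1) *
             (\<Prod>i\<in>{2..n}. indicator (\<Gamma> i) (x i - x (i - 1))))
      = path_integral \<mu> Q A' n
        (\<lambda>y. indicator (\<Gamma> 0) (y 0) * indicator (\<Gamma> 1) (y 1) *
             (\<Prod>i\<in>{2..n}. indicator (\<Gamma> i) (y (\<pi> i) - y (\<pi> i - 1))))"
  shows "\<exists>(M :: ('t set \<Rightarrow> real) measure) X.
           Q_Markov M \<A> Q X \<and> distr M borel (X (min_set \<A>)) = \<mu>"
proof -
  interpret indexing \<A> by unfold_locales (rule assms(1))
  interpret consistent_transition_system \<A> \<mu> Q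
    by (intro consistent_transition_system.intro consistent_transition_system_axioms.intro
        indexing_axioms assms)
  show ?thesis using Q_Markov_process initial_law by blast
qed

end
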